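(* For large enough $n$, there exist Holt-Klee orientations of the $n$-cube which are not linearly inducible. Indeed, as $n$ grows, the fraction of Holt-Klee orientations of the $n$-cube which are linearly inducible approaches $0$ rapidly.
   Context: The graph of the $n$-cube has vertex set $\{0,1\}^n$, with two vertices adjacent iff they differ in exactly one coordinate. Its nonempty faces are the subsets of $\{0,1\}^n$ obtained by fixing some of the coordinates (a $k$-face has exactly $k$ free coordinates; the whole cube is the $n$-face). An orientation of the $n$-cube means an assignment of a direction to every edge of this (labeled) graph; orientations are counted as distinct labeled objects. A realization of the $n$-cube is a convex polytope $Q\subset\mathbb{R}^n$ combinatorially equivalent to the $n$-cube, i.e. with the same face lattice (so the vertices of $Q$ are identified with $\{0,1\}^n$). An orientation is linearly inducible (also called an LP-orientation) if there exist a realization $Q\subset\mathbb{R}^n$ and a linear functional $f$ on $\mathbb{R}^n$, taking distinct values at adjacent vertices of $Q$, such that every edge $vw$ is oriented from $v$ to $w$ if and only if $f(v)<f(w)$. An orientation is Holt-Klee if: (1) the induced orientation on every face, including the whole polytope, has a unique source and a unique sink; (2) the orientation is acyclic (has no directed cycles); (3) for each $k$-face, there are at least $k$ directed paths inside the face from its source to its sink that are pairwise disjoint except at the endpoints. The word "rapidly" is not quantified in the theorem itself. The bounds from which the theorem is derived are: the number of linearly inducible orientations of the $n$-cube is at most $p(n)^{q(n)}$, and the number of Holt-Klee orientations of the $n$-cube is at least $2^{2^n/r(n)}$, where $p,q,r$ are polynomials in $n$. *)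

theory Defs
  imports "HOL-Analysis.Analysis" "HOL-Analysis.Finite_Function_Topology"
    "HOL-Computational_Algebra.Polynomial"
begin

section \<open>The graph of the cube, its faces and its orientations\<close>

definition cube :: "nat \<Rightarrow> (nat \<Rightarrow> nat) set" where
  "cube n = {..<n} \<rightarrow>\<^sub>E {0, 1}"

definition cube_adj :: "nat \<Rightarrow> (nat \<Rightarrow> nat) \<Rightarrow> (nat \<Rightarrow> nat) \<Rightarrow> bool" where
  "cube_adj n v w \<longleftrightarrow> v \<in> cube n \<and> w \<in> cube n \<and> (\<exists>!i. i < n \<and> v i \<noteq> w i)"

text \<open>Here \<open>I\<close> is the set of free coordinates; the others are fixed to the values prescribed by \<open>a\<close>.\<close>

definition cube_face :: "nat \<Rightarrow> nat \<Rightarrow> (nat \<Rightarrow> nat) set \<Rightarrow> bool" where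
  "cube_face n k F \<longleftrightarrow>
     (\<exists>I a. I \<subseteq> {..<n} \<and> card I = k \<and> a \<in> cube n \<and>
            F = {x \<in> cube n. \<forall>i \<in> {..<n} - I. x i = a i})"

text \<open>The face lattice contains the empty face, which is not of the form above.\<close>

definition cube_face_lattice :: "nat \<Rightarrow> (nat \<Rightarrow> nat) set set" where
  "cube_face_lattice n = insert {} {F. \<exists>k. cube_face n k F}"

text \<open>An orientation is the set of its directed edges; \<open>(v, w) \<in> D\<close> means that the edge
  joining \<open>v\<close> and \<open>w\<close> is directed from \<open>v\<close> to \<open>w\<close>.\<close>

type_synonym digraph = "((nat \<Rightarrow> nat) \<times> (nat \<Rightarrow> nat)) set"

definition cube_orientation :: "nat \<Rightarrow> digraph \<Rightarrow> bool" where
  "cube_orientation n D \<longleftrightarrow>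
     D \<subseteq> {(v, w). cube_adj n v w} \<and>
     (\<forall>v w. cube_adj n v w \<longrightarrow> ((v, w) \<in> D \<longleftrightarrow> (w, v) \<notin> D))"

lemma finite_cube_orientations: "finite {D. cube_orientation n D}"
proof -
  have "finite (cube n)"
    by (auto simp: cube_def intro: finite_PiE)
  then have "finite (Pow (cube n \<times> cube n))"
    by simp
  moreover have "{D. cube_orientation n D} \<subseteq> Pow (cube n \<times> cube n)"
    by (auto simp: cube_orientation_def cube_adj_def)
  ultimately show ?thesis
    by (rule finite_subset[rotated])
qed


section \<open>Holt-Klee orientations\<close>

definition is_source :: "digraph \<Rightarrow> (nat \<Rightarrow> nat) set \<Rightarrow> (nat \<Rightarrow> nat) \<Rightarrow> bool" where
  "is_source D F s \<longleftrightarrow> s \<in> F \<and> (\<forall>u \<in> F. (u, s) \<notin> D)"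

definition is_sink :: "digraph \<Rightarrow> (nat \<Rightarrow> nat) set \<Rightarrow> (nat \<Rightarrow> nat) \<Rightarrow> bool" where
  "is_sink D F t \<longleftrightarrow> t \<in> F \<and> (\<forall>u \<in> F. (t, u) \<notin> D)"

text \<open>A directed path is represented by the list of its vertices.\<close>

definition dpath_in ::
    "digraph \<Rightarrow> (nat \<Rightarrow> nat) set \<Rightarrow> (nat \<Rightarrow> nat) \<Rightarrow> (nat \<Rightarrow> nat) \<Rightarrow> (nat \<Rightarrow> nat) list \<Rightarrow> bool" where
  "dpath_in D F s t xs \<longleftrightarrow>
     xs \<noteq> [] \<and> hd xs = s \<and> last xs = t \<and> set xs \<subseteq> F \<and> distinct xs \<and>
     successively (\<lambda>v w. (v, w) \<in> D) xs"

definition holt_klee :: "nat \<Rightarrow> digraph \<Rightarrow> bool" where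
  "holt_klee n D \<longleftrightarrow>
     cube_orientation n D \<and>
     (\<forall>k F. cube_face n k F \<longrightarrow> (\<exists>!s. is_source D F s) \<and> (\<exists>!t. is_sink D F t)) \<and>
     acyclic D \<and>
     (\<forall>k F s t. cube_face n k F \<and> is_source D F s \<and> is_sink D F t \<longrightarrow>
        (\<exists>P. finite P \<and> k \<le> card P \<and> (\<forall>xs \<in> P. dpath_in D F s t xs) \<and>
             (\<forall>xs \<in> P. \<forall>ys \<in> P. xs \<noteq> ys \<longrightarrow> set xs \<inter> set ys = {s, t})))"


section \<open>Realizations and linearly inducible orientations\<close>

text \<open>As the dimension \<open>n\<close> varies, \<open>\<real>\<^sup>n\<close> is taken to be the subspace of the space of finitely
  supported real sequences on which all coordinates outside \<open>{..<n}\<close> vanish. Convex hulls and faces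
  of a subset of a linear subspace do not depend on the ambient space.\<close>

definition Rn :: "nat \<Rightarrow> (nat \<Rightarrow>\<^sub>0 real) set" where
  "Rn n = {x. Poly_Mapping.keys x \<subseteq> {..<n}}"

text \<open>\<open>\<Phi>\<close> is an isomorphism from the face lattice of the cube to that of \<open>Q\<close> (both including the
  empty face), and \<open>\<phi>\<close> is the resulting identification of the vertices.\<close>

definition cube_realization ::
    "nat \<Rightarrow> (nat \<Rightarrow>\<^sub>0 real) set \<Rightarrow> ((nat \<Rightarrow> nat) \<Rightarrow> (nat \<Rightarrow>\<^sub>0 real)) \<Rightarrow> bool" where
  "cube_realization n Q \<phi> \<longleftrightarrow>
     Q \<subseteq> Rn n \<and> polytope Q \<and>
     (\<exists>\<Phi>. bij_betw \<Phi> (cube_face_lattice n) {T. T face_of Q} \<and>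
          (\<forall>F \<in> cube_face_lattice n. \<forall>G \<in> cube_face_lattice n. \<Phi> F \<subseteq> \<Phi> G \<longleftrightarrow> F \<subseteq> G) \<and>
          (\<forall>v \<in> cube n. \<Phi> {v} = {\<phi> v}))"

text \<open>The functional \<open>f\<close> is defined on the ambient space, but only its restriction to \<open>Rn n\<close> matters,
  and every linear functional on \<open>Rn n\<close> extends.\<close>

definition lp_orientation :: "nat \<Rightarrow> digraph \<Rightarrow> bool" where
  "lp_orientation n D \<longleftrightarrow>
     cube_orientation n D \<and>
     (\<exists>Q \<phi> f. cube_realization n Q \<phi> \<and> linear (f :: (nat \<Rightarrow>\<^sub>0 real) \<Rightarrow> real) \<and>
        (\<forall>v w. cube_adj n v w \<longrightarrow> f (\<phi> v) \<noteq> f (\<phi> w)) \<and>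
        (\<forall>v w. cube_adj n v w \<longrightarrow> ((v, w) \<in> D \<longleftrightarrow> f (\<phi> v) < f (\<phi> w))))"

definition lp_fraction :: "nat \<Rightarrow> real" where
  "lp_fraction n =
     real (card {D. holt_klee n D \<and> lp_orientation n D}) / real (card {D. holt_klee n D})"

end

theory Submission
  imports Defs "HOL-Real_Asymp.Real_Asymp" "Jordan_Normal_Form.Determinant"
begin

text \<open>The theorem is a counting argument: the linearly inducible orientations of the \<open>n\<close>-cube
  are at most \<open>2\<close> to a polynomial in \<open>n\<close> in number (\<open>card_lp_orientations_le\<close>), whereas there are at
  least \<open>2 powr (2 ^ n / (2 * n))\<close> Holt-Klee orientations (\<open>card_holt_klee_ge_powr\<close>).

  \<^emph>\<open>Upper bound.\<close> A realization is described by its \<open>2 * n\<close> facet functionals together with the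
  objective, that is, by \<open>O(n\<^sup>2)\<close> real parameters. At a vertex, the facet functionals through it and
  the edge vectors leaving it form dual bases up to negative factors, so by Cramer's rule an edge
  direction is read off from the signs of two \<open>n \<times> n\<close> determinants in the parameters
  (\<open>edge_direction_by_determinants\<close>). An orientation is therefore encoded by the sign pattern of
  at most \<open>(n + 1) * 2 ^ n\<close> polynomials of degree \<open>n\<close> in \<open>O(n\<^sup>2)\<close> variables, and it remains to bound the
  number of sign patterns that nonvanishing values of given polynomials can have: it is single
  exponential in the number \<open>k\<close> of variables (\<open>card_sign_patterns_le\<close>).

  Such a bound is usually derived from Morse theory and Bezout's theorem; here is a short cut. Let
  \<open>P\<close> be the product of the polynomials and \<open>G x = \<bar>x\<bar>\<^sup>2 + 1 / (P x)\<^sup>2\<close>. On every sign cell, for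
  every \<open>y\<close>, the function \<open>G x - x \<bullet> y\<close> tends to infinity at the boundary and at infinity, hence it
  attains its minimum, so the cell contains a solution of \<open>\<nabla> G x = y\<close>. The components of the gradient
  are rational functions with denominator \<open>P ^ 3\<close>. Counting dimensions of spaces of polynomials shows
  that a linear form \<open>h\<close> satisfies a nontrivial polynomial relation \<open>R (h x) (\<nabla> G x) = 0\<close> whose
  degree \<open>A\<close> in \<open>h\<close> is explicit (\<open>fibre_relation\<close>). For suitable \<open>y\<close> and \<open>h\<close>, the polynomial
  \<open>\<lambda>t. R t y\<close> is nonzero and \<open>h\<close> separates the chosen solutions in the different cells; so there
  are at most \<open>A\<close> cells.

  \<^emph>\<open>Lower bound.\<close> Direct all edges of two opposite facets upwards, and direct the edges between
  these facets according to the membership of the underlying vertex of the \<open>(n - 1)\<close>-cube in a set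
  \<open>U\<close>. If \<open>U\<close> is upward closed, the result is a Holt-Klee orientation
  (\<open>holt_klee_twisted_orientation\<close>). The middle layer of the \<open>(n - 1)\<close>-cube is an antichain, and
  every subset of it, together with all higher layers, is such a \<open>U\<close>.\<close>

section \<open>Polynomial functions of several variables\<close>

text \<open>The number \<open>d\<close> is only an upper bound for the total degree, which makes the rules closed under
  weakening. A point assigns a value to every element of the type \<open>'v\<close>, but only the coordinates in
  \<open>V\<close> are read (\<open>polyfun_cong_on\<close>); in this way the number of variables can vary without changing
  the type.\<close>

inductive polyfun :: "'v set \<Rightarrow> nat \<Rightarrow> (('v \<Rightarrow> real) \<Rightarrow> real) \<Rightarrow> bool" for V where
  polyfun_const: "polyfun V d (\<lambda>_. c)"
| polyfun_var: "i \<in> V \<Longrightarrow> polyfun V (Suc d) (\<lambda>x. x i)"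
| polyfun_add: "polyfun V d f \<Longrightarrow> polyfun V d g \<Longrightarrow> polyfun V d (\<lambda>x. f x + g x)"
| polyfun_mult: "polyfun V d f \<Longrightarrow> polyfun V e g \<Longrightarrow> polyfun V (d + e) (\<lambda>x. f x * g x)"

lemma polyfun_mono:
  assumes "polyfun V d f" "d \<le> e"
  shows "polyfun V e f"
  using assms
proof (induction arbitrary: e rule: polyfun.induct)
  case (polyfun_var i d)
  then show ?case by (cases e) (auto intro: polyfun.intros)
next
  case (polyfun_mult d f d' g)
  have "polyfun V (d + (e - d)) (\<lambda>x. f x * g x)"
    by (rule polyfun.polyfun_mult) (use polyfun_mult in auto)
  with polyfun_mult.prems show ?case by simp
qed (auto intro: polyfun.intros)

lemma polyfun_cmult: "polyfun V d f \<Longrightarrow> polyfun V d (\<lambda>x. c * f x)"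
  using polyfun_mult[OF polyfun_const[of V 0 c]] by auto

lemma polyfun_diff:
  assumes "polyfun V d f" "polyfun V d g"
  shows "polyfun V d (\<lambda>x. f x - g x)"
  using polyfun_add[OF assms(1) polyfun_cmult[OF assms(2), of "-1"]] by simp

lemma polyfun_sum:
  "(\<And>j. j \<in> J \<Longrightarrow> polyfun V d (f j)) \<Longrightarrow> polyfun V d (\<lambda>x. \<Sum>j\<in>J. f j x)"
  by (induction J rule: infinite_finite_induct) (auto intro: polyfun.intros)

lemma polyfun_prod:
  "(\<And>j. j \<in> J \<Longrightarrow> polyfun V d (f j)) \<Longrightarrow> polyfun V (card J * d) (\<lambda>x. \<Prod>j\<in>J. f j x)"
  by (induction J rule: infinite_finite_induct) (auto intro: polyfun.intros)

lemma polyfun_power: "polyfun V d f \<Longrightarrow> polyfun V (m * d) (\<lambda>x. f x ^ m)"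
  by (induction m) (auto intro: polyfun.intros)

lemma polyfun_continuous_on: "polyfun V d f \<Longrightarrow> continuous_on S f"
  by (induction rule: polyfun.induct)
     (auto intro!: continuous_intros continuous_on_product_coordinates[THEN continuous_on_subset])

lemma polyfun_partial_derivative:
  assumes "polyfun V d f"
  obtains g where "polyfun V d g"
    "\<And>x. ((\<lambda>t. f (x(i := t))) has_real_derivative g x) (at (x i))"
proof -
  have "\<exists>g. polyfun V d g \<and> (\<forall>x. ((\<lambda>t. f (x(i := t))) has_real_derivative g x) (at (x i)))"
    using assms
  proof (induction rule: polyfun.induct)
    case (polyfun_const d c)
    then show ?case by (intro exI[of _ "\<lambda>_. 0"]) (auto intro: polyfun.intros)
  next
    case (polyfun_var j d)
    then show ?case
      by (intro exI[of _ "\<lambda>_. if j = i then 1 else 0"]) (auto intro: polyfun.intros)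
  next
    case (polyfun_add d f1 f2)
    then obtain g1 g2 where "polyfun V d g1" "polyfun V d g2"
      "\<And>x. ((\<lambda>t. f1 (x(i := t))) has_real_derivative g1 x) (at (x i))"
      "\<And>x. ((\<lambda>t. f2 (x(i := t))) has_real_derivative g2 x) (at (x i))" by blast
    then show ?case
      by (intro exI[of _ "\<lambda>x. g1 x + g2 x"] conjI allI polyfun.polyfun_add DERIV_add)
  next
    case (polyfun_mult d f1 e f2)
    then obtain g1 g2 where g: "polyfun V d g1" "polyfun V e g2"
      "\<And>x. ((\<lambda>t. f1 (x(i := t))) has_real_derivative g1 x) (at (x i))"
      "\<And>x. ((\<lambda>t. f2 (x(i := t))) has_real_derivative g2 x) (at (x i))" by blast
    show ?case
    proof (intro exI[of _ "\<lambda>x. g1 x * f2 x + g2 x * f1 x"] conjI allI)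
      show "polyfun V (d + e) (\<lambda>x. g1 x * f2 x + g2 x * f1 x)"
        using polyfun.polyfun_mult[OF g(1) polyfun_mult.hyps(2)]
          polyfun.polyfun_mult[OF g(2) polyfun_mult.hyps(1)]
        by (intro polyfun.polyfun_add) (simp_all add: add.commute)
      show "((\<lambda>t. f1 (x(i := t)) * f2 (x(i := t))) has_real_derivative
          g1 x * f2 x + g2 x * f1 x) (at (x i))" for x
        using DERIV_mult[OF g(3)[of x] g(4)[of x]] by simp
    qed
  qed
  with that show ?thesis by blast
qed

text \<open>Total degree at most \<open>d\<close> bounds every single exponent by \<open>d\<close>. The resulting box of exponents is
  larger than necessary, but its cardinality \<open>(d + 1) ^ card V\<close> is simpler than the number of
  monomials of total degree at most \<open>d\<close>, and it has the same exponential growth in \<open>card V\<close>.\<close>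

lemma polyfun_monomials:
  assumes "polyfun V d f" and V: "finite V"
  obtains c where "\<And>x. f x = (\<Sum>m\<in>V \<rightarrow>\<^sub>E {..d}. c m * (\<Prod>i\<in>V. x i ^ m i))"
proof -
  have fin: "finite (V \<rightarrow>\<^sub>E {..d})" for d :: nat using V by (intro finite_PiE) auto
  have "\<exists>c. \<forall>x. f x = (\<Sum>m\<in>V \<rightarrow>\<^sub>E {..d}. c m * (\<Prod>i\<in>V. x i ^ m i))"
    using assms(1)
  proof (induction rule: polyfun.induct)
    case (polyfun_const d c)
    define z where "z = (\<lambda>i. if i \<in> V then 0 else undefined :: nat)"
    have z: "z \<in> V \<rightarrow>\<^sub>E {..d}" by (auto simp: z_def)
    have "(\<Prod>i\<in>V. x i ^ z i) = 1" for x :: "'a \<Rightarrow> real" by (simp add: z_def)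
    then have 1: "c = (\<Sum>m\<in>{z}. (if m = z then c else 0) * (\<Prod>i\<in>V. x i ^ m i))"
      for x :: "'a \<Rightarrow> real" by simp
    have 2: "(\<Sum>m\<in>{z}. (if m = z then c else 0) * (\<Prod>i\<in>V. x i ^ m i)) = (\<Sum>m\<in>V \<rightarrow>\<^sub>E {..d}. (if m = z then c else 0) * (\<Prod>i\<in>V. x i ^ m i))"
      for x :: "'a \<Rightarrow> real"
      by (rule sum.mono_neutral_left) (use z fin in auto)
    show ?case using 1 unfolding 2 by (intro exI[of _ "\<lambda>m. if m = z then c else 0"] allI)
  next
    case (polyfun_var j d)
    define z where "z = (\<lambda>i. if i \<in> V then (if i = j then 1 else 0) else undefined :: nat)"
    have z: "z \<in> V \<rightarrow>\<^sub>E {..Suc d}" by (auto simp: z_def)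
    have "(\<Prod>i\<in>V. x i ^ z i) = x j" for x :: "'a \<Rightarrow> real"
    proof -
      have "(\<Prod>i\<in>V. x i ^ z i) = (\<Prod>i\<in>V. if i = j then x i else 1)"
        by (intro prod.cong) (auto simp: z_def)
      then show ?thesis using V polyfun_var by simp
    qed
    then have 1: "x j = (\<Sum>m\<in>{z}. (if m = z then 1 else 0) * (\<Prod>i\<in>V. x i ^ m i))"
      for x :: "'a \<Rightarrow> real" by simp
    have 2: "(\<Sum>m\<in>{z}. (if m = z then 1 else 0) * (\<Prod>i\<in>V. x i ^ m i)) =
        (\<Sum>m\<in>V \<rightarrow>\<^sub>E {..Suc d}. (if m = z then 1 else 0) * (\<Prod>i\<in>V. x i ^ m i))"
      for x :: "'a \<Rightarrow> real"
      by (rule sum.mono_neutral_left) (use z fin in auto)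
    show ?case using 1 unfolding 2 by (intro exI[of _ "\<lambda>m. if m = z then 1 else 0"] allI)
  next
    case (polyfun_add d f g)
    then obtain c1 c2 where "\<forall>x. f x = (\<Sum>m\<in>V \<rightarrow>\<^sub>E {..d}. c1 m * (\<Prod>i\<in>V. x i ^ m i))"
      "\<forall>x. g x = (\<Sum>m\<in>V \<rightarrow>\<^sub>E {..d}. c2 m * (\<Prod>i\<in>V. x i ^ m i))" by blast
    then show ?case
      by (intro exI[of _ "\<lambda>m. c1 m + c2 m"]) (simp add: sum.distrib ring_distribs)
  next
    case (polyfun_mult d f e g)
    from polyfun_mult.IH(1) obtain c1 where c1:
      "\<And>x. f x = (\<Sum>m\<in>V \<rightarrow>\<^sub>E {..d}. c1 m * (\<Prod>i\<in>V. x i ^ m i))" by blast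
    from polyfun_mult.IH(2) obtain c2 where c2:
      "\<And>x. g x = (\<Sum>m\<in>V \<rightarrow>\<^sub>E {..e}. c2 m * (\<Prod>i\<in>V. x i ^ m i))" by blast
    let ?A = "V \<rightarrow>\<^sub>E {..d}" and ?B = "V \<rightarrow>\<^sub>E {..e}" and ?C = "V \<rightarrow>\<^sub>E {..d + e}"
    let ?add = "\<lambda>(m, m'). \<lambda>i. if i \<in> V then m i + m' i else undefined :: nat"
    have fin: "finite (?A \<times> ?B)" "finite ?C" using V by (auto intro!: finite_PiE)
    have im: "?add ` (?A \<times> ?B) \<subseteq> ?C"
      by (force simp: PiE_def Pi_def extensional_def intro: add_mono)
    show ?case
    proof (intro exI[of _ "\<lambda>r. \<Sum>(m, m')\<in>{p \<in> ?A \<times> ?B. ?add p = r}. c1 m * c2 m'"] allI)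
      fix x :: "'a \<Rightarrow> real"
      let ?F = "\<lambda>(m, m'). c1 m * c2 m' * (\<Prod>i\<in>V. x i ^ ?add (m, m') i)"
      have "f x * g x = (\<Sum>p\<in>?A \<times> ?B. ?F p)"
        unfolding c1 c2 sum_product sum.cartesian_product
        by (intro sum.cong) (auto simp: power_add prod.distrib)
      also have "\<dots> = (\<Sum>r\<in>?C. \<Sum>p\<in>{p \<in> ?A \<times> ?B. ?add p = r}. ?F p)"
        by (rule sum.group[OF fin im, symmetric])
      also have "\<dots> = (\<Sum>r\<in>?C. (\<Sum>(m, m')\<in>{p \<in> ?A \<times> ?B. ?add p = r}. c1 m * c2 m') *
          (\<Prod>i\<in>V. x i ^ r i))"
        by (intro sum.cong) (auto simp: sum_distrib_right intro!: sum.cong)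
      finally show "f x * g x = \<dots>" .
    qed
  qed
  with that show ?thesis by blast
qed

text \<open>Gaussian elimination, one equation at a time: a pivot \<open>p\<close> is used to eliminate the unknown \<open>c p\<close>
  from the remaining equations.\<close>

lemma homogeneous_system_nontrivial_solution:
  fixes M :: "'i \<Rightarrow> 'j \<Rightarrow> real"
  assumes "finite J" "finite I" "card J < card I"
  shows "\<exists>c. (\<exists>i\<in>I. c i \<noteq> 0) \<and> (\<forall>j\<in>J. (\<Sum>i\<in>I. c i * M i j) = 0)"
  using assms
proof (induction J arbitrary: I M rule: finite_induct)
  case empty
  then have "I \<noteq> {}" by auto
  then show ?case by (intro exI[of _ "\<lambda>_. 1"]) auto
next
  case (insert j J)
  show ?case
  proof (cases "\<forall>i\<in>I. M i j = 0")
    case True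
    then show ?thesis using insert.IH[of I M] insert.prems insert.hyps by auto
  next
    case False
    then obtain p where p: "p \<in> I" "M p j \<noteq> 0" by auto
    let ?I = "I - {p}" and ?M = "\<lambda>i j'. M i j' - M i j / M p j * M p j'"
    have "card J < card ?I" using insert.prems insert.hyps p by auto
    then obtain c where c: "\<exists>i\<in>?I. c i \<noteq> 0" "\<And>j'. j' \<in> J \<Longrightarrow> (\<Sum>i\<in>?I. c i * ?M i j') = 0"
      using insert.IH[of ?I ?M] insert.prems by auto
    define c' where "c' = c(p := - (\<Sum>i\<in>?I. c i * M i j) / M p j)"
    have split: "(\<Sum>i\<in>I. c' i * M i j') = c' p * M p j' + (\<Sum>i\<in>?I. c i * M i j')" for j'
      using insert.prems p by (subst sum.remove[of I p]) (auto simp: c'_def intro!: sum.cong)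
    have "(\<Sum>i\<in>I. c' i * M i j) = 0"
      unfolding split using p by (simp add: c'_def)
    moreover have "(\<Sum>i\<in>I. c' i * M i j') = 0" if "j' \<in> J" for j'
      using c(2)[OF that] unfolding split
      by (simp add: c'_def algebra_simps sum_subtractf sum_distrib_left sum_divide_distrib sum_distrib_right)
    moreover have "\<exists>i\<in>I. c' i \<noteq> 0" using c(1) by (auto simp: c'_def)
    ultimately show ?thesis by (intro exI[of _ c']) auto
  qed
qed

lemma polyfun_linear_dependency:
  assumes "finite V" "finite I" and F: "\<And>i. i \<in> I \<Longrightarrow> polyfun V d (F i)"
    and large: "(d + 1) ^ card V < card I"
  shows "\<exists>c. (\<exists>i\<in>I. c i \<noteq> 0) \<and> (\<forall>x. (\<Sum>i\<in>I. c i * F i x) = 0)"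
proof -
  let ?M = "V \<rightarrow>\<^sub>E {..d}"
  have "\<forall>i\<in>I. \<exists>a. \<forall>x. F i x = (\<Sum>m\<in>?M. a m * (\<Prod>v\<in>V. x v ^ m v))"
    using polyfun_monomials[OF F \<open>finite V\<close>] by metis
  then obtain a where a: "\<And>i x. i \<in> I \<Longrightarrow> F i x = (\<Sum>m\<in>?M. a i m * (\<Prod>v\<in>V. x v ^ m v))"
    by metis
  have "card ?M = (d + 1) ^ card V" using \<open>finite V\<close> by (simp add: card_PiE)
  with large obtain c where c: "\<exists>i\<in>I. c i \<noteq> 0" "\<And>m. m \<in> ?M \<Longrightarrow> (\<Sum>i\<in>I. c i * a i m) = 0"
    using homogeneous_system_nontrivial_solution[of ?M I a] \<open>finite V\<close> \<open>finite I\<close> finite_PiE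
    by (metis finite_atMost)
  have "(\<Sum>i\<in>I. c i * F i x) = 0" for x
  proof -
    have "(\<Sum>i\<in>I. c i * F i x) = (\<Sum>i\<in>I. \<Sum>m\<in>?M. c i * a i m * (\<Prod>v\<in>V. x v ^ m v))"
      by (simp add: a sum_distrib_left mult.assoc)
    also have "\<dots> = (\<Sum>m\<in>?M. (\<Sum>i\<in>I. c i * a i m) * (\<Prod>v\<in>V. x v ^ m v))"
      by (subst sum.swap) (simp add: sum_distrib_right)
    finally show ?thesis using c(2) by simp
  qed
  with c(1) show ?thesis by blast
qed

text \<open>This makes the substitution \<open>y i = s ^ (C ^ i)\<close> turn distinct monomials with exponents below
  \<open>C\<close> into distinct powers of \<open>s\<close>.\<close>

lemma base_expansion_unique:
  fixes b b' :: "nat \<Rightarrow> nat"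
  assumes "\<And>i. i < k \<Longrightarrow> b i < C" "\<And>i. i < k \<Longrightarrow> b' i < C"
    and "(\<Sum>i<k. b i * C ^ i) = (\<Sum>i<k. b' i * C ^ i)" "i < k"
  shows "b i = b' i"
  using assms
proof (induction k arbitrary: b b' i)
  case (Suc k)
  have *: "(\<Sum>i<Suc k. b i * C ^ i) = b 0 + C * (\<Sum>i<k. b (Suc i) * C ^ i)" for b
    by (subst sum.lessThan_Suc_shift) (simp add: sum_distrib_left mult_ac)
  have eq: "b 0 + C * (\<Sum>i<k. b (Suc i) * C ^ i) = b' 0 + C * (\<Sum>i<k. b' (Suc i) * C ^ i)"
    using Suc.prems(3) unfolding * .
  have C: "b 0 < C" "b' 0 < C" using Suc.prems by auto
  have "b 0 = (b 0 + C * (\<Sum>i<k. b (Suc i) * C ^ i)) mod C" using C by simp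
  also have "\<dots> = b' 0" unfolding eq using C by simp
  finally have 0: "b 0 = b' 0" .
  with eq C have "(\<Sum>i<k. b (Suc i) * C ^ i) = (\<Sum>i<k. b' (Suc i) * C ^ i)" by auto
  then have "b (Suc j) = b' (Suc j)" if "j < k" for j
    using Suc.IH[of "\<lambda>i. b (Suc i)" "\<lambda>i. b' (Suc i)" j] Suc.prems(1,2) that by auto
  with 0 Suc.prems(4) show ?case by (cases i) auto
qed auto

section \<open>Counting sign patterns of polynomials\<close>

text \<open>Up to the linear term, this is the function \<open>G\<close> of the introduction; it is only considered where
  \<open>P\<close> does not vanish.\<close>

definition barrier :: "'v set \<Rightarrow> (('v \<Rightarrow> real) \<Rightarrow> real) \<Rightarrow> ('v \<Rightarrow> real) \<Rightarrow> ('v \<Rightarrow> real) \<Rightarrow> real" where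
  "barrier V P y x = (\<Sum>i\<in>V. x i ^ 2 - y i * x i) + 1 / P x ^ 2"

text \<open>The cell is open and unbounded in general, but the sublevel set of the barrier through the
  given point \<open>x0\<close> is compact: after completing the square, both \<open>(x i - y i / 2)\<^sup>2\<close> and
  \<open>1 / (P x)\<^sup>2\<close> are bounded on it by a constant \<open>C\<close>. The second bound keeps it away from the
  boundary of the cell. The signs of the \<open>p j\<close> on the cell are prescribed by \<open>\<sigma>\<close>.\<close>

lemma barrier_attains_min_on_cell:
  fixes p :: "'j \<Rightarrow> ('v \<Rightarrow> real) \<Rightarrow> real"
  assumes V: "finite V" and J: "finite J" and p: "\<And>j. j \<in> J \<Longrightarrow> polyfun V d (p j)"
    and x0: "\<And>i. i \<notin> V \<Longrightarrow> x0 i = 0" "\<And>j. j \<in> J \<Longrightarrow> 0 < \<sigma> j * p j x0"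
  defines "P \<equiv> \<lambda>x. \<Prod>j\<in>J. p j x"
  obtains x where "\<And>i. i \<notin> V \<Longrightarrow> x i = 0" "\<And>j. j \<in> J \<Longrightarrow> 0 < \<sigma> j * p j x"
    "\<And>z. (\<And>i. i \<notin> V \<Longrightarrow> z i = 0) \<Longrightarrow> (\<And>j. j \<in> J \<Longrightarrow> 0 < \<sigma> j * p j z) \<Longrightarrow>
      barrier V P y x \<le> barrier V P y z"
proof -
  let ?G = "barrier V P y"
  define C where "C = ?G x0 + (\<Sum>i\<in>V. y i ^ 2 / 4)"
  define R where "R = 1 + C"
  have G: "?G x = (\<Sum>i\<in>V. (x i - y i / 2) ^ 2) + 1 / P x ^ 2 - (\<Sum>i\<in>V. y i ^ 2 / 4)" for x
    unfolding barrier_def by (simp add: power2_diff sum.distrib sum_subtractf power_divide algebra_simps)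
  have P0: "P x \<noteq> 0" if "\<And>j. j \<in> J \<Longrightarrow> 0 < \<sigma> j * p j x" for x
    unfolding P_def using J that by (fastforce simp: prod_zero_iff)
  have C: "C = (\<Sum>i\<in>V. (x0 i - y i / 2) ^ 2) + 1 / P x0 ^ 2" unfolding C_def G by simp
  have "0 < 1 / P x0 ^ 2" using P0[OF x0(2)] by simp
  then have Cpos: "0 < C" unfolding C by (simp add: add_nonneg_pos sum_nonneg)
  \<comment> \<open>A compact subset of the cell that contains every point of the cell at which the barrier is at most its value at \<open>x0\<close>.\<close>
  define K where "K = (\<Pi>\<^sub>E i\<in>UNIV. if i \<in> V then {y i / 2 - R .. y i / 2 + R} else {0}) \<inter>
    (\<Inter>j\<in>J. {x. 0 \<le> \<sigma> j * p j x}) \<inter> {x. 1 / C \<le> P x ^ 2}"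
  have contP: "continuous_on S P" for S
    using polyfun_continuous_on[OF polyfun_prod[of J V d p, OF p]] unfolding P_def by blast
  have compactK: "compact K"
    unfolding K_def
  proof (intro compact_Int_closed closed_INT ballI)
    show "compact (\<Pi>\<^sub>E i\<in>UNIV. if i \<in> V then {y i / 2 - R .. y i / 2 + R} else {0})"
      using compactin_PiE[of "\<lambda>_. euclidean :: real topology" "UNIV :: 'v set"
          "\<lambda>i. if i \<in> V then {y i / 2 - R .. y i / 2 + R} else {0}"]
      by (simp add: euclidean_product_topology)
    show "closed {x. 0 \<le> \<sigma> j * p j x}" if "j \<in> J" for j
      using polyfun_continuous_on[OF p[OF that]]
      by (intro closed_Collect_le continuous_intros) auto
    show "closed {x. 1 / C \<le> P x ^ 2}"
      by (intro closed_Collect_le continuous_intros contP)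
  qed
  have inK: "z \<in> K" if z: "\<And>i. i \<notin> V \<Longrightarrow> z i = 0" "\<And>j. j \<in> J \<Longrightarrow> 0 < \<sigma> j * p j z"
    and le: "?G z \<le> ?G x0" for z
  proof -
    have le': "(\<Sum>i\<in>V. (z i - y i / 2) ^ 2) + 1 / P z ^ 2 \<le> C"
      using le unfolding C_def G[of z] by simp
    have "0 \<le> (\<Sum>i\<in>V. (z i - y i / 2) ^ 2)" by (simp add: sum_nonneg)
    with le' have "1 / P z ^ 2 \<le> C" by linarith
    then have "1 / C \<le> P z ^ 2"
      using P0[OF z(2)] Cpos by (simp add: divide_simps mult.commute)
    moreover have "z i \<in> {y i / 2 - R .. y i / 2 + R}" if "i \<in> V" for i
    proof -
      have "(z i - y i / 2) ^ 2 \<le> (\<Sum>i\<in>V. (z i - y i / 2) ^ 2)"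
        using V that by (intro member_le_sum) auto
      also have "\<dots> \<le> C"
      proof -
        have "0 \<le> 1 / P z ^ 2" by simp
        with le' show ?thesis by linarith
      qed
      also have "C \<le> R ^ 2" using Cpos unfolding R_def by (simp add: power2_eq_square algebra_simps)
      finally have "\<bar>z i - y i / 2\<bar> \<le> R"
        using Cpos by (intro power2_le_imp_le[of "\<bar>_\<bar>"]) (auto simp: R_def)
      then show ?thesis by (auto simp: abs_le_iff)
    qed
    ultimately show ?thesis using z(1) less_imp_le[OF z(2)] by (auto simp: K_def)
  qed
  have Kpos: "0 < \<sigma> j * p j x" if "x \<in> K" "j \<in> J" for x j
  proof -
    have "0 < 1 / C" using Cpos by simp
    also have "1 / C \<le> P x ^ 2" using that by (auto simp: K_def)
    finally have "P x \<noteq> 0" by auto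
    then have "p j x \<noteq> 0" using J that unfolding P_def by (auto simp: prod_zero_iff)
    moreover have "\<sigma> j \<noteq> 0" using x0(2)[OF \<open>j \<in> J\<close>] by auto
    moreover have "0 \<le> \<sigma> j * p j x" using that by (auto simp: K_def)
    ultimately show ?thesis by (simp add: less_le)
  qed
  have "x0 \<in> K" using inK[of x0] x0 by auto
  moreover have "continuous_on K ?G"
    unfolding barrier_def using P0[OF Kpos]
    by (intro continuous_intros contP continuous_on_product_coordinates[THEN continuous_on_subset]) auto
  ultimately obtain x where x: "x \<in> K" "\<And>z. z \<in> K \<Longrightarrow> ?G x \<le> ?G z"
    using continuous_attains_inf[OF compactK, of ?G] by blast
  have "x i = 0" if "i \<notin> V" for i
  proof -
    have "x i \<in> (if i \<in> V then {y i / 2 - R .. y i / 2 + R} else {0})"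
      using x(1) unfolding K_def by blast
    with that show ?thesis by simp
  qed
  moreover have "?G x \<le> ?G z"
    if "\<And>i. i \<notin> V \<Longrightarrow> z i = 0" "\<And>j. j \<in> J \<Longrightarrow> 0 < \<sigma> j * p j z" for z
    using x(2)[of z] x(2)[OF \<open>x0 \<in> K\<close>] inK[OF that] by linarith
  ultimately show ?thesis using that Kpos[OF x(1)] by blast
qed

text \<open>At a minimum of the barrier in the open cell all partial derivatives
  \<open>2 * x i - y i - 2 * DP i x / P x ^ 3\<close> vanish, so \<open>y\<close> is the gradient there. Thus each
  cell meets every fibre of the gradient map, which is what allows the cells to be counted in one
  fibre.\<close>

lemma cell_contains_prescribed_gradient:
  fixes p :: "'j \<Rightarrow> ('v \<Rightarrow> real) \<Rightarrow> real"
  assumes V: "finite V" and J: "finite J" and p: "\<And>j. j \<in> J \<Longrightarrow> polyfun V d (p j)"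
    and x0: "\<And>i. i \<notin> V \<Longrightarrow> x0 i = 0" "\<And>j. j \<in> J \<Longrightarrow> 0 < \<sigma> j * p j x0"
    and DP: "\<And>i x. i \<in> V \<Longrightarrow>
      ((\<lambda>t. \<Prod>j\<in>J. p j (x(i := t))) has_real_derivative DP i x) (at (x i))"
  obtains x where "\<And>i. i \<notin> V \<Longrightarrow> x i = 0" "\<And>j. j \<in> J \<Longrightarrow> 0 < \<sigma> j * p j x"
    "\<And>i. i \<in> V \<Longrightarrow> 2 * x i * (\<Prod>j\<in>J. p j x) ^ 3 - 2 * DP i x = y i * (\<Prod>j\<in>J. p j x) ^ 3"
proof -
  define P where "P = (\<lambda>x. \<Prod>j\<in>J. p j x)"
  obtain x where x: "\<And>i. i \<notin> V \<Longrightarrow> x i = 0" "\<And>j. j \<in> J \<Longrightarrow> 0 < \<sigma> j * p j x"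
    "\<And>z. (\<And>i. i \<notin> V \<Longrightarrow> z i = 0) \<Longrightarrow> (\<And>j. j \<in> J \<Longrightarrow> 0 < \<sigma> j * p j z) \<Longrightarrow>
      barrier V P y x \<le> barrier V P y z"
    using barrier_attains_min_on_cell[where p = p and \<sigma> = \<sigma> and y = y, OF V J p x0, folded P_def] by blast
  have P0: "P x \<noteq> 0"
    unfolding P_def using J x(2) by (fastforce simp: prod_zero_iff)
  have "2 * x i * P x ^ 3 - 2 * DP i x = y i * P x ^ 3" if i: "i \<in> V" for i
  proof -
    let ?G = "\<lambda>t. barrier V P y (x(i := t))"
    have "(?G has_real_derivative (2 * x i - y i) - 2 * DP i x / P x ^ 3) (at (x i))"
    proof -
      have G: "?G = (\<lambda>t. (\<Sum>j\<in>V - {i}. x j ^ 2 - y j * x j) + (t ^ 2 - y i * t) + 1 / P (x(i := t)) ^ 2)"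
      proof
        fix t
        have "(\<Sum>j\<in>V - {i}. (x(i := t)) j ^ 2 - y j * (x(i := t)) j) = (\<Sum>j\<in>V - {i}. x j ^ 2 - y j * x j)"
          by (rule sum.cong) auto
        then show "?G t = (\<Sum>j\<in>V - {i}. x j ^ 2 - y j * x j) + (t ^ 2 - y i * t) + 1 / P (x(i := t)) ^ 2"
          unfolding barrier_def by (subst sum.remove[OF V i]) simp
      qed
      have "((\<lambda>t. P (x(i := t))) has_real_derivative DP i x) (at (x i))"
        unfolding P_def by (rule DP[OF i])
      from DERIV_power[OF this, of 2]
      have "((\<lambda>t. P (x(i := t)) ^ 2) has_real_derivative 2 * (DP i x * P x)) (at (x i))" by simp
      from DERIV_inverse'[OF this]
      have 1: "((\<lambda>t. inverse (P (x(i := t)) ^ 2)) has_real_derivative - 2 * DP i x / P x ^ 3) (at (x i))"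
        using P0 by (simp add: field_simps power2_eq_square power3_eq_cube)
      have 2: "((\<lambda>t. (\<Sum>j\<in>V - {i}. x j ^ 2 - y j * x j) + (t ^ 2 - y i * t)) has_real_derivative
          2 * x i - y i) (at (x i))"
        by (auto intro!: derivative_eq_intros)
      from DERIV_add[OF 2 1] show ?thesis unfolding G by (simp add: inverse_eq_divide)
    qed
    moreover have "\<exists>e>0. \<forall>t. \<bar>x i - t\<bar> < e \<longrightarrow> ?G (x i) \<le> ?G t"
    proof -
      have "\<forall>j\<in>J. \<forall>\<^sub>F t in at (x i). 0 < \<sigma> j * p j (x(i := t))"
      proof
        fix j assume j: "j \<in> J"
        obtain g where "((\<lambda>t. p j (x(i := t))) has_real_derivative g x) (at (x i))"
          using polyfun_partial_derivative[OF p[OF j]] by metis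
        then have "(\<lambda>t. p j (x(i := t))) \<midarrow>x i\<rightarrow> p j x"
          using DERIV_isCont[of "\<lambda>t. p j (x(i := t))" "g x" "x i"] by (simp add: isCont_def)
        then have "(\<lambda>t. \<sigma> j * p j (x(i := t))) \<midarrow>x i\<rightarrow> \<sigma> j * p j x"
          by (intro tendsto_intros)
        then show "\<forall>\<^sub>F t in at (x i). 0 < \<sigma> j * p j (x(i := t))"
          using x(2)[OF j] by (rule order_tendstoD)
      qed
      then have "\<forall>\<^sub>F t in at (x i). \<forall>j\<in>J. 0 < \<sigma> j * p j (x(i := t))"
        using J by (simp add: eventually_ball_finite)
      then obtain e where e: "e > 0" "\<And>t. t \<noteq> x i \<Longrightarrow> dist t (x i) < e \<Longrightarrow> \<forall>j\<in>J. 0 < \<sigma> j * p j (x(i := t))"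
        unfolding eventually_at by auto
      have "?G (x i) \<le> ?G t" if "\<bar>x i - t\<bar> < e" for t
      proof (cases "t = x i")
        case False
        with e(2)[of t] that have "\<forall>j\<in>J. 0 < \<sigma> j * p j (x(i := t))"
          by (auto simp: dist_real_def abs_minus_commute)
        moreover have "(x(i := t)) k = 0" if "k \<notin> V" for k using that x(1) i by auto
        ultimately show ?thesis using x(3)[of "x(i := t)"] by simp
      qed auto
      with e(1) show ?thesis by blast
    qed
    ultimately have "(2 * x i - y i) - 2 * DP i x / P x ^ 3 = 0"
      using DERIV_local_min by blast
    then show ?thesis using P0 by (simp add: field_simps)
  qed
  with that x show ?thesis unfolding P_def by blast
qed

text \<open>A nonzero polynomial in several variables does not vanish identically on the curve
  \<open>y i = s ^ ((B + 1) ^ e i)\<close> if its exponents are at most \<open>B\<close> (Kronecker substitution), since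
  it becomes a nonzero polynomial in \<open>s\<close>. The parameter \<open>s\<close> is chosen among the natural numbers
  so that only countably many fibres have to be considered.\<close>

lemma monomial_curve_nonvanishing:
  fixes c :: "('v \<Rightarrow> nat) \<Rightarrow> real"
  assumes V: "finite V" and e: "bij_betw e V {..<card V}"
    and nz: "m \<in> V \<rightarrow>\<^sub>E {..B}" "c m \<noteq> 0"
  shows "\<exists>s::nat. (\<Sum>m\<in>V \<rightarrow>\<^sub>E {..B}. c m * (\<Prod>i\<in>V. (real s ^ (B + 1) ^ e i) ^ m i)) \<noteq> 0"
proof -
  let ?M = "V \<rightarrow>\<^sub>E {..B}"
  define \<kappa> where "\<kappa> m = (\<Sum>i\<in>V. m i * (B + 1) ^ e i)" for m :: "'v \<Rightarrow> nat"
  define e' where "e' = inv_into V e"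
  have e': "e' l \<in> V" "e (e' l) = l" if "l < card V" for l
    using that bij_betw_inv_into_right[OF e, of l] bij_betw_apply[OF bij_betw_inv_into[OF e], of l]
    by (auto simp: e'_def)
  have e_less: "e i < card V" "e' (e i) = i" if "i \<in> V" for i
    using that bij_betw_apply[OF e] bij_betw_inv_into_left[OF e] by (auto simp: e'_def)
  have \<kappa>: "\<kappa> m = (\<Sum>l<card V. m (e' l) * (B + 1) ^ l)" for m
    unfolding \<kappa>_def
    by (subst sum.reindex_bij_betw[OF e, symmetric]) (auto simp: e_less intro!: sum.cong)
  have inj: "inj_on \<kappa> ?M"
  proof (rule inj_onI)
    fix m m' assume m: "m \<in> ?M" "m' \<in> ?M" and eq: "\<kappa> m = \<kappa> m'"
    have lt: "m (e' l) < B + 1" "m' (e' l) < B + 1" if "l < card V" for l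
      using m e'(1)[OF that] by (auto simp: PiE_iff less_Suc_eq_le)
    have "m (e' l) = m' (e' l)" if "l < card V" for l
      by (rule base_expansion_unique[of "card V" _ "B + 1", OF lt]) (use eq that \<kappa> in auto)
    then have "m i = m' i" if "i \<in> V" for i
      using e_less[OF that] by metis
    with m show "m = m'" by (metis PiE_ext)
  qed
  have fin: "finite ?M" using V by (intro finite_PiE) auto
  define r where "r = (\<Sum>m\<in>?M. monom (c m) (\<kappa> m))"
  have "coeff r (\<kappa> m) = (\<Sum>m'\<in>?M. if m' = m then c m' else 0)"
    unfolding r_def coeff_sum coeff_monom
    by (intro sum.cong refl) (use inj nz in \<open>auto simp: inj_on_def\<close>)
  also have "\<dots> = c m" using nz fin by simp
  finally have "r \<noteq> 0" using nz by auto
  then have "finite {x. poly r x = 0}" by (rule poly_roots_finite)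
  moreover have "infinite (range real)" using range_inj_infinite[of real] by (simp add: inj_on_def)
  ultimately have "\<not> range real \<subseteq> {x. poly r x = 0}"
    using finite_subset[of "range real" "{x. poly r x = 0}"] by blast
  then obtain s :: nat where "poly r (real s) \<noteq> 0" by auto
  moreover have "poly r (real s) = (\<Sum>m\<in>?M. c m * (\<Prod>i\<in>V. (real s ^ (B + 1) ^ e i) ^ m i))"
    unfolding r_def poly_sum poly_monom \<kappa>_def
    by (simp add: power_sum power_mult mult.commute flip: power_mult)
  ultimately show ?thesis by auto
qed

text \<open>For two distinct points the values of \<open>c\<close> for which \<open>\<Sum>i\<in>V. c ^ e i * x i\<close> fails to separate
  them are the roots of a nonzero polynomial, hence finite in number. Countably many pairs of points
  exclude only countably many values of \<open>c\<close>. One form has to work for all fibres \<open>s\<close>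
  at once, because the fibre is chosen only after the relation that the form satisfies.\<close>

lemma separating_linear_form:
  fixes X :: "'s \<Rightarrow> nat \<Rightarrow> 'v \<Rightarrow> real"
  assumes V: "finite V" and e: "inj_on e V" and S: "finite S"
    and X: "\<And>\<sigma> s i. i \<notin> V \<Longrightarrow> X \<sigma> s i = 0" "\<And>s. inj_on (\<lambda>\<sigma>. X \<sigma> s) S"
  obtains c :: real where "\<And>s. inj_on (\<lambda>\<sigma>. \<Sum>i\<in>V. c ^ e i * X \<sigma> s i) S"
proof -
  \<comment> \<open>The values of \<open>c\<close> that identify the points \<open>X \<sigma> s\<close> and \<open>X \<tau> s\<close>.\<close>
  define bad where "bad = (\<lambda>(\<sigma>, \<tau>, s). {c::real. (\<Sum>i\<in>V. c ^ e i * X \<sigma> s i) = (\<Sum>i\<in>V. c ^ e i * X \<tau> s i)})"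
  let ?B = "\<Union>t\<in>{(\<sigma>, \<tau>, s). \<sigma> \<in> S \<and> \<tau> \<in> S \<and> \<sigma> \<noteq> \<tau>}. bad t"
  have "countable (\<Union>t\<in>{(\<sigma>, \<tau>, s). \<sigma> \<in> S \<and> \<tau> \<in> S \<and> \<sigma> \<noteq> \<tau>}. bad t)"
  proof (rule countable_UN)
    have "{(\<sigma>, \<tau>, s). \<sigma> \<in> S \<and> \<tau> \<in> S \<and> \<sigma> \<noteq> \<tau>} \<subseteq> S \<times> S \<times> (UNIV :: nat set)" by auto
    then show "countable {(\<sigma>, \<tau>, s::nat). \<sigma> \<in> S \<and> \<tau> \<in> S \<and> \<sigma> \<noteq> \<tau>}"
      by (rule countable_subset) (use S in \<open>auto intro: countable_finite\<close>)
    fix t assume "t \<in> {(\<sigma>, \<tau>, s::nat). \<sigma> \<in> S \<and> \<tau> \<in> S \<and> \<sigma> \<noteq> \<tau>}"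
    then obtain \<sigma> \<tau> s where t: "t = (\<sigma>, \<tau>, s)" "\<sigma> \<in> S" "\<tau> \<in> S" "\<sigma> \<noteq> \<tau>" by auto
    then have "X \<sigma> s \<noteq> X \<tau> s" using X(2)[of s] by (auto simp: inj_on_def)
    then obtain i where i: "X \<sigma> s i \<noteq> X \<tau> s i" by auto
    then have iV: "i \<in> V" using X(1)[of i \<sigma> s] X(1)[of i \<tau> s] by force
    define r where "r = (\<Sum>j\<in>V. monom (X \<sigma> s j - X \<tau> s j) (e j))"
    have "coeff r (e i) = (\<Sum>j\<in>V. if j = i then X \<sigma> s j - X \<tau> s j else 0)"
      unfolding r_def coeff_sum coeff_monom
      by (intro sum.cong refl) (use e iV in \<open>auto simp: inj_on_def\<close>)
    also have "\<dots> \<noteq> 0" using V iV i by simp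
    finally have "r \<noteq> 0" by auto
    then have "finite {x. poly r x = 0}" by (rule poly_roots_finite)
    moreover have "bad t = {x. poly r x = 0}"
      unfolding t bad_def r_def poly_sum poly_monom
      by (auto simp: left_diff_distrib sum_subtractf right_diff_distrib mult.commute[of "X _ _ _"])
    ultimately show "countable (bad t)" by (auto intro: countable_finite)
  qed
  then have "?B \<noteq> UNIV" using uncountable_UNIV_real by auto
  then obtain c where "c \<notin> ?B" by blast
  then have "inj_on (\<lambda>\<sigma>. \<Sum>i\<in>V. c ^ e i * X \<sigma> s i) S" for s
    unfolding inj_on_def bad_def by fastforce
  with that show ?thesis by blast
qed

lemma polyfun_cong_on:
  assumes "polyfun V d f" "\<And>i. i \<in> V \<Longrightarrow> x i = y i"
  shows "f x = f y"
  using assms by (induction rule: polyfun.induct) auto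

text \<open>The rational functions \<open>N i / Q\<close> and the form \<open>h\<close> are more functions than there are variables,
  hence algebraically dependent. Quantitatively, the products \<open>h ^ a * (N / Q) ^ m\<close> with \<open>a \<le> A\<close>
  and \<open>m i \<le> A\<close> become polynomials after multiplication by \<open>Q ^ (A * card V)\<close>, there are
  \<open>(A + 1) ^ (card V + 1)\<close> of them, and they lie in a space of dimension at most
  \<open>(card V * d + 1) ^ card V * (A + 1) ^ card V\<close>. The choice of \<open>A\<close> makes this dimension equal to
  \<open>A * (A + 1) ^ card V\<close>, which is just too small.\<close>

lemma fibre_relation:
  fixes N :: "'v \<Rightarrow> ('v \<Rightarrow> real) \<Rightarrow> real"
  assumes V: "finite V" and N: "\<And>i. i \<in> V \<Longrightarrow> polyfun V d (N i)" and Q: "polyfun V d Q"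
    and h: "polyfun V 1 h"
  defines "A \<equiv> (card V * d + 1) ^ card V"
  shows "\<exists>c. (\<exists>a\<le>A. \<exists>m\<in>V \<rightarrow>\<^sub>E {..A}. c a m \<noteq> 0) \<and>
    (\<forall>x y. Q x \<noteq> 0 \<longrightarrow> (\<forall>i\<in>V. N i x = y i * Q x) \<longrightarrow>
      (\<Sum>a\<le>A. (\<Sum>m\<in>V \<rightarrow>\<^sub>E {..A}. c a m * (\<Prod>i\<in>V. y i ^ m i)) * h x ^ a) = 0)"
proof -
  let ?M = "V \<rightarrow>\<^sub>E {..A}"
  define F where "F = (\<lambda>(a, m) x. h x ^ a * (\<Prod>i\<in>V. N i x ^ m i * Q x ^ (A - m i)))"
  have fin: "finite ({..A} \<times> ?M)" using V by (auto intro!: finite_PiE)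
  have F: "polyfun V (A + card V * (A * d)) (F p)" if p: "p \<in> {..A} \<times> ?M" for p
  proof -
    obtain a m where p': "p = (a, m)" "a \<le> A" "m \<in> ?M" using p by auto
    have "polyfun V (A * d) (\<lambda>x. N i x ^ m i * Q x ^ (A - m i))" if i: "i \<in> V" for i
    proof -
      have "m i \<le> A" using p' i by auto
      then have "m i * d + (A - m i) * d = A * d" by (simp flip: add_mult_distrib)
      then show ?thesis
        using polyfun_mult[OF polyfun_power[OF N[OF i], of "m i"] polyfun_power[OF Q, of "A - m i"]]
        by simp
    qed
    then show ?thesis
      unfolding p'(1) F_def prod.case
      by (intro polyfun_mult polyfun_prod polyfun_mono[OF polyfun_power[OF h, of a]]) (use p' in auto)
  qed
  have "(A + card V * (A * d) + 1) ^ card V < card ({..A} \<times> ?M)"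
  proof -
    have "A + card V * (A * d) + 1 \<le> (card V * d + 1) * (A + 1)" by (simp add: algebra_simps)
    then have "(A + card V * (A * d) + 1) ^ card V \<le> ((card V * d + 1) * (A + 1)) ^ card V"
      by (rule power_mono) simp
    also have "\<dots> = A * (A + 1) ^ card V" unfolding A_def by (simp only: power_mult_distrib)
    also have "\<dots> < (A + 1) * (A + 1) ^ card V" by simp
    also have "\<dots> = card ({..A} \<times> ?M)" using V by (simp add: card_cartesian_product card_PiE)
    finally show ?thesis .
  qed
  then have "\<exists>c. (\<exists>p\<in>{..A} \<times> ?M. c p \<noteq> 0) \<and> (\<forall>x. (\<Sum>p\<in>{..A} \<times> ?M. c p * F p x) = 0)"
    by (intro polyfun_linear_dependency[OF V fin F])
  then obtain c where c: "\<exists>p\<in>{..A} \<times> ?M. c p \<noteq> 0" "\<forall>x. (\<Sum>p\<in>{..A} \<times> ?M. c p * F p x) = 0"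
    by blast
  show ?thesis
  proof (intro exI[of _ "\<lambda>a m. c (a, m)"] conjI allI impI)
    show "\<exists>a\<le>A. \<exists>m\<in>?M. c (a, m) \<noteq> 0" using c(1) by auto
    fix x y assume Qx: "Q x \<noteq> 0" and y: "\<forall>i\<in>V. N i x = y i * Q x"
    have "F (a, m) x = h x ^ a * (\<Prod>i\<in>V. y i ^ m i) * Q x ^ (A * card V)" if m: "m \<in> ?M" for a m
    proof -
      have "N i x ^ m i * Q x ^ (A - m i) = y i ^ m i * Q x ^ A" if i: "i \<in> V" for i
      proof -
        have "m i \<le> A" using m i by auto
        then have "Q x ^ A = Q x ^ m i * Q x ^ (A - m i)" by (simp flip: power_add)
        then show ?thesis by (simp add: y[rule_format, OF i] power_mult_distrib)
      qed
      then have "(\<Prod>i\<in>V. N i x ^ m i * Q x ^ (A - m i)) = (\<Prod>i\<in>V. y i ^ m i * Q x ^ A)"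
        by (rule prod.cong[OF refl])
      then show ?thesis
        by (simp only: F_def prod.case) (simp add: prod.distrib power_mult)
    qed
    then have "(\<Sum>a\<le>A. (\<Sum>m\<in>?M. c (a, m) * (\<Prod>i\<in>V. y i ^ m i)) * h x ^ a) * Q x ^ (A * card V) =
        (\<Sum>a\<le>A. \<Sum>m\<in>?M. c (a, m) * F (a, m) x)"
      unfolding sum_distrib_right by (intro sum.cong refl) (simp add: mult_ac)
    also have "\<dots> = (\<Sum>p\<in>{..A} \<times> ?M. c p * F p x)"
      by (simp add: sum.cartesian_product case_prod_beta')
    also have "\<dots> = 0" using c(2) by blast
    finally show "(\<Sum>a\<le>A. (\<Sum>m\<in>?M. c (a, m) * (\<Prod>i\<in>V. y i ^ m i)) * h x ^ a) = 0"
      using Qx by auto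
  qed
qed

text \<open>In a fibre of the gradient map, choose one point \<open>X T s\<close> in the cell of each sign pattern \<open>T\<close>.
  The relation of \<open>fibre_relation\<close>, evaluated on this fibre, is a nonzero polynomial in one variable
  that vanishes at the value of the separating form \<open>h\<close> at each of these points, so its degree bounds
  the number of patterns. A sign pattern is represented by the set of polynomials that are positive.\<close>

theorem card_sign_patterns_le:
  fixes p :: "'j \<Rightarrow> ('v \<Rightarrow> real) \<Rightarrow> real"
  assumes V: "finite V" and J: "finite J" and p: "\<And>j. j \<in> J \<Longrightarrow> polyfun V d (p j)"
  defines "D \<equiv> card J * d"
  shows "card {{j \<in> J. 0 < p j x} |x. \<forall>j\<in>J. p j x \<noteq> 0} \<le> (card V * (3 * D + 1) + 1) ^ card V"
proof -
  define S where "S = {{j \<in> J. 0 < p j x} |x. \<forall>j\<in>J. p j x \<noteq> 0}"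
  have finS: "finite S" by (rule finite_subset[of _ "Pow J"]) (auto simp: S_def J)
  define sg where "sg T j = (if j \<in> T then 1 else -1 :: real)" for T and j :: 'j
  define P where "P = (\<lambda>x. \<Prod>j\<in>J. p j x)"
  have P: "polyfun V D P" unfolding P_def D_def by (rule polyfun_prod[OF p])
  obtain e where e: "bij_betw e V {..<card V}"
    using ex_bij_betw_finite_nat[OF V] by (auto simp: atLeast0LessThan)
  have "\<forall>i. \<exists>g. polyfun V D g \<and> (\<forall>x. ((\<lambda>t. P (x(i := t))) has_real_derivative g x) (at (x i)))"
    using polyfun_partial_derivative[OF P] by metis
  then obtain DP where DP: "\<And>i. polyfun V D (DP i)"
    "\<And>i x. ((\<lambda>t. P (x(i := t))) has_real_derivative DP i x) (at (x i))" by metis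
  \<comment> \<open>The partial derivatives of \<open>\<bar>x\<bar>\<^sup>2 + 1 / (P x)\<^sup>2\<close> are \<open>N i x / P x ^ 3\<close>.\<close>
  define N where "N i x = 2 * x i * P x ^ 3 - 2 * DP i x" for i x
  define A where "A = (card V * (3 * D + 1) + 1) ^ card V"
  define y where "y s i = real s ^ (A + 1) ^ e i" for s :: nat and i

  have "\<exists>x. (\<forall>i. i \<notin> V \<longrightarrow> x i = 0) \<and> (\<forall>j\<in>J. 0 < sg T j * p j x) \<and>
      (\<forall>i\<in>V. N i x = y s i * P x ^ 3)" if "T \<in> S" for T s
  proof -
    obtain x where x: "T = {j \<in> J. 0 < p j x}" "\<forall>j\<in>J. p j x \<noteq> 0"
      using \<open>T \<in> S\<close> by (auto simp: S_def)
    \<comment> \<open>The coordinates outside \<open>V\<close> are normalized to \<open>0\<close>, since \<open>h\<close> can only separate points by their coordinates in \<open>V\<close>.\<close>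
    define x0 where "x0 i = (if i \<in> V then x i else 0)" for i
    have "p j x0 = p j x" if "j \<in> J" for j
      by (rule polyfun_cong_on[OF p[OF that]]) (auto simp: x0_def)
    with x have pos: "0 < sg T j * p j x0" if "j \<in> J" for j
      using that by (auto simp: sg_def not_less less_le)
    have "\<exists>z. (\<forall>i. i \<notin> V \<longrightarrow> z i = 0) \<and> (\<forall>j\<in>J. 0 < sg T j * p j z) \<and>
      (\<forall>i\<in>V. 2 * z i * (\<Prod>j\<in>J. p j z) ^ 3 - 2 * DP i z = y s i * (\<Prod>j\<in>J. p j z) ^ 3)"
      using cell_contains_prescribed_gradient[OF V J p _ pos DP(2)[unfolded P_def], of "y s"]
      by (metis x0_def)
    then show ?thesis unfolding N_def P_def .
  qed
  then have "\<forall>T s. \<exists>x. T \<in> S \<longrightarrow> (\<forall>i. i \<notin> V \<longrightarrow> x i = 0) \<and> (\<forall>j\<in>J. 0 < sg T j * p j x) \<and>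
      (\<forall>i\<in>V. N i x = y s i * P x ^ 3)" by blast
  then obtain X0 where X0: "\<And>T s. T \<in> S \<Longrightarrow> (\<forall>i. i \<notin> V \<longrightarrow> X0 T s i = 0) \<and>
      (\<forall>j\<in>J. 0 < sg T j * p j (X0 T s)) \<and> (\<forall>i\<in>V. N i (X0 T s) = y s i * P (X0 T s) ^ 3)"
    by metis
  define X where "X T s = (if T \<in> S then X0 T s else (\<lambda>_. 0))" for T s
  have X: "i \<notin> V \<Longrightarrow> X T s i = 0" "T \<in> S \<Longrightarrow> j \<in> J \<Longrightarrow> 0 < sg T j * p j (X T s)"
    "T \<in> S \<Longrightarrow> i \<in> V \<Longrightarrow> N i (X T s) = y s i * P (X T s) ^ 3" for T s i j
    using X0 by (auto simp: X_def)
  have XP: "P (X T s) \<noteq> 0" if "T \<in> S" for T s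
  proof
    assume "P (X T s) = 0"
    then obtain j where "j \<in> J" "p j (X T s) = 0" using J by (auto simp: P_def)
    with X(2)[OF that, of j s] show False by simp
  qed
  have recover: "T = {j \<in> J. 0 < p j (X T s)}" if "T \<in> S" for T s
    using X(2)[OF that, of _ s] that by (fastforce simp: sg_def S_def split: if_splits)
  have "inj_on (\<lambda>T. X T s) S" for s
    by (rule inj_onI) (metis recover)
  then obtain c where c: "\<And>s. inj_on (\<lambda>T. \<Sum>i\<in>V. c ^ e i * X T s i) S"
    using separating_linear_form[where X = X, OF V bij_betw_imp_inj_on[OF e] finS X(1)] by blast
  define h where "h x = (\<Sum>i\<in>V. c ^ e i * x i)" for x :: "'v \<Rightarrow> real"
  have h_poly: "polyfun V 1 h"
    unfolding h_def using polyfun_var[of _ V 0] by (intro polyfun_sum polyfun_cmult) auto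
  have N_poly: "polyfun V (3 * D + 1) (N i)" if "i \<in> V" for i
  proof -
    have 1: "polyfun V (1 + 3 * D) (\<lambda>x. x i * P x ^ 3)"
      using polyfun_mult[OF polyfun_var[OF that, of 0] polyfun_power[OF P, of 3]] by simp
    show ?thesis
      unfolding N_def mult.assoc
      by (intro polyfun_diff polyfun_cmult polyfun_mono[OF 1] polyfun_mono[OF DP(1)]) auto
  qed
  have Q_poly: "polyfun V (3 * D + 1) (\<lambda>x. P x ^ 3)"
    by (rule polyfun_mono[OF polyfun_power[OF P]]) auto
  have "\<exists>l. (\<exists>a\<le>A. \<exists>m\<in>V \<rightarrow>\<^sub>E {..A}. l a m \<noteq> 0) \<and>
    (\<forall>x y. P x ^ 3 \<noteq> 0 \<longrightarrow> (\<forall>i\<in>V. N i x = y i * P x ^ 3) \<longrightarrow>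
      (\<Sum>a\<le>A. (\<Sum>m\<in>V \<rightarrow>\<^sub>E {..A}. l a m * (\<Prod>i\<in>V. y i ^ m i)) * h x ^ a) = 0)"
    unfolding A_def by (rule fibre_relation[OF V N_poly Q_poly h_poly])
  then obtain l where l: "\<exists>a\<le>A. \<exists>m\<in>V \<rightarrow>\<^sub>E {..A}. l a m \<noteq> 0"
    "\<forall>x y. P x ^ 3 \<noteq> 0 \<longrightarrow> (\<forall>i\<in>V. N i x = y i * P x ^ 3) \<longrightarrow>
      (\<Sum>a\<le>A. (\<Sum>m\<in>V \<rightarrow>\<^sub>E {..A}. l a m * (\<Prod>i\<in>V. y i ^ m i)) * h x ^ a) = 0"
    by blast
  from l(1) obtain a0 m0 where am: "a0 \<le> A" "m0 \<in> V \<rightarrow>\<^sub>E {..A}" "l a0 m0 \<noteq> 0" by blast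
  from monomial_curve_nonvanishing[where c = "l a0", OF V e am(2,3)]
  obtain s where s: "(\<Sum>m\<in>V \<rightarrow>\<^sub>E {..A}. l a0 m * (\<Prod>i\<in>V. y s i ^ m i)) \<noteq> 0"
    unfolding y_def by blast
  define R where "R = (\<Sum>a\<le>A. monom (\<Sum>m\<in>V \<rightarrow>\<^sub>E {..A}. l a m * (\<Prod>i\<in>V. y s i ^ m i)) a)"
  have "coeff R a0 \<noteq> 0" using s am(1) by (simp add: R_def coeff_sum)
  then have "R \<noteq> 0" by auto
  have "card S = card ((\<lambda>T. h (X T s)) ` S)"
    using c[of s] unfolding h_def by (rule card_image[symmetric])
  also have "\<dots> \<le> card {t. poly R t = 0}"
  proof (rule card_mono)
    show "finite {t. poly R t = 0}" using \<open>R \<noteq> 0\<close> by (rule poly_roots_finite)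
    show "(\<lambda>T. h (X T s)) ` S \<subseteq> {t. poly R t = 0}"
      using l(2)[rule_format, of "X _ s" "y s"] XP X(3) by (auto simp: R_def poly_sum poly_monom)
  qed
  also have "\<dots> \<le> degree R" using \<open>R \<noteq> 0\<close> by (rule card_poly_roots_bound)
  also have "\<dots> \<le> A" unfolding R_def
    by (intro degree_sum_le) (auto intro: order_trans[OF degree_monom_le])
  finally show ?thesis unfolding S_def A_def .
qed

section \<open>Supporting functionals of faces\<close>

text \<open>This is Gordan's theorem modulo a subspace. The proof by induction needs no topology and hence no
  finite dimension. When a point \<open>v\<close> is added to \<open>S\<close>, either the hull of \<open>S\<close> still misses
  \<open>W + \<real> v\<close>, and a functional vanishing on this larger space can be perturbed to be positive
  at \<open>v\<close>; or the hull contains some \<open>w + t v\<close>, where \<open>t > 0\<close> because otherwise the hull of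
  \<open>insert v S\<close> would meet \<open>W\<close>, and then every functional that is positive on \<open>S\<close> and zero on \<open>W\<close>
  is positive at \<open>v\<close>.\<close>

lemma separating_functional_modulo_subspace:
  fixes S :: "'a::real_vector set"
  assumes "finite S" "subspace W" "convex hull S \<inter> W = {}"
  shows "\<exists>g::'a \<Rightarrow> real. linear g \<and> (\<forall>w\<in>W. g w = 0) \<and> (\<forall>x\<in>S. 0 < g x)"
  using assms
proof (induction S arbitrary: W rule: finite_induct)
  case empty
  show ?case by (intro exI[of _ "\<lambda>_. 0"]) (simp add: linear_zero)
next
  case (insert v S)
  have W: "subspace W" by fact
  have disj: "x \<notin> W" if "x \<in> convex hull (insert v S)" for x using that insert.prems(2) by blast
  have v: "v \<notin> W" by (rule disj) (simp add: hull_inc)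
  have hull_mono: "convex hull S \<subseteq> convex hull (insert v S)" by (rule hull_mono) auto
  let ?W' = "{w + t *\<^sub>R v |w t. w \<in> W}"
  show ?case
  proof (cases "convex hull S \<inter> ?W' = {}")
    case True
    have "subspace ?W'"
    proof (rule subspaceI)
      show "0 \<in> ?W'" using subspace_0[OF W] by (auto intro!: exI[of _ 0])
      fix x y assume "x \<in> ?W'" "y \<in> ?W'"
      then obtain w t w' t' where "x = w + t *\<^sub>R v" "y = w' + t' *\<^sub>R v" "w \<in> W" "w' \<in> W" by auto
      then show "x + y \<in> ?W'"
        by (intro CollectI exI[of _ "w + w'"] exI[of _ "t + t'"])
          (auto simp: algebra_simps intro: subspace_add[OF W])
    next
      fix c x assume "x \<in> ?W'"
      then obtain w t where "x = w + t *\<^sub>R v" "w \<in> W" by auto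
      then show "c *\<^sub>R x \<in> ?W'"
        by (intro CollectI exI[of _ "c *\<^sub>R w"] exI[of _ "c * t"])
          (auto simp: algebra_simps intro: subspace_scale[OF W])
    qed
    from insert.IH[OF this True] obtain g :: "'a \<Rightarrow> real"
      where g: "linear g" "\<And>w. w \<in> ?W' \<Longrightarrow> g w = 0" "\<And>x. x \<in> S \<Longrightarrow> 0 < g x" by blast
    have inW': "w + t *\<^sub>R v \<in> ?W'" if "w \<in> W" for w t using that by blast
    have g0: "g w = 0" if "w \<in> W" for w using g(2)[OF inW'[OF that, of 0]] by simp
    have gv: "g v = 0" using g(2)[OF inW'[OF subspace_0[OF W], of 1]] by simp
    obtain B where B: "B \<subseteq> W" "independent B" "W \<subseteq> span B" using basis_exists by metis
    \<comment> \<open>A functional \<open>k\<close> that vanishes on \<open>W\<close> with \<open>k v = 1\<close>; a small multiple of it is the perturbation.\<close>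
    have "v \<notin> span B" using B(1) W v span_minimal by blast
    then have "independent (insert v B)" using B(2) by (simp add: independent_insert)
    from linear_independent_extend[OF this, of "\<lambda>x. if x = v then 1 else 0 :: real"]
    obtain k :: "'a \<Rightarrow> real" where k: "linear k" "\<forall>x\<in>insert v B. k x = (if x = v then 1 else 0)"
      by auto
    have "k x = 0" if "x \<in> B" for x using k(2) that B(1) v by auto
    then have k0: "k w = 0" if "w \<in> W" for w
      using linear_eq_0_on_span[OF k(1), of B w] B(3) that by auto
    obtain e where e: "e > 0" "\<And>x. x \<in> S \<Longrightarrow> e * \<bar>k x\<bar> < g x"
    proof -
      have "\<forall>\<^sub>F e in at_right 0. \<forall>x\<in>S. e * \<bar>k x\<bar> < g x"
      proof (intro eventually_ball_finite[OF insert.hyps(1)] ballI)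
        fix x assume "x \<in> S"
        have "((\<lambda>e. e * \<bar>k x\<bar>) \<longlongrightarrow> 0 * \<bar>k x\<bar>) (at_right 0)" by (intro tendsto_intros)
        then show "\<forall>\<^sub>F e in at_right 0. e * \<bar>k x\<bar> < g x"
          using g(3)[OF \<open>x \<in> S\<close>] by (intro order_tendstoD) auto
      qed
      then have "\<forall>\<^sub>F e in at_right (0::real). 0 < e \<and> (\<forall>x\<in>S. e * \<bar>k x\<bar> < g x)"
        by (intro eventually_conj eventually_at_right_less)
      with that show ?thesis using eventually_happens'[OF trivial_limit_at_right_real] by blast
    qed
    show ?thesis
    proof (intro exI[of _ "\<lambda>x. g x + e * k x"] conjI ballI)
      show "linear (\<lambda>x. g x + e * k x)"
        using g(1) k(1) linear_compose_add linear_compose_scale_right[of k e] by auto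
      show "g w + e * k w = 0" if "w \<in> W" for w using g0 k0 that by simp
      fix x assume x: "x \<in> insert v S"
      show "0 < g x + e * k x"
      proof (cases "x = v")
        case True
        then show ?thesis using gv k(2) e(1) by simp
      next
        case False
        then have "e * \<bar>k x\<bar> < g x" using x e(2) by simp
        moreover have "e * (- k x) \<le> e * \<bar>k x\<bar>" using e(1) by (intro mult_left_mono) auto
        then have "- (e * k x) \<le> e * \<bar>k x\<bar>" by simp
        ultimately show ?thesis by linarith
      qed
    qed
  next
    case False
    then obtain w t where wt: "w + t *\<^sub>R v \<in> convex hull S" "w \<in> W" by blast
    have "convex hull S \<inter> W = {}" using insert.prems(2) hull_mono by blast
    with insert.IH[OF W] obtain g :: "'a \<Rightarrow> real"
      where g: "linear g" "\<And>w. w \<in> W \<Longrightarrow> g w = 0" "\<And>x. x \<in> S \<Longrightarrow> 0 < g x" by blast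
    have "0 < t"
    proof (rule ccontr)
      assume "\<not> 0 < t"
      then have t: "t \<le> 0" by simp
      let ?z = "(1 / (1 - t)) *\<^sub>R (w + t *\<^sub>R v) + (- t / (1 - t)) *\<^sub>R v"
      have "?z \<in> convex hull (insert v S)"
      proof (rule convexD[OF convex_convex_hull])
        show "w + t *\<^sub>R v \<in> convex hull insert v S" using wt(1) hull_mono by blast
        show "v \<in> convex hull insert v S" by (simp add: hull_inc)
        show "1 / (1 - t) + - t / (1 - t) = 1" using t by (simp add: diff_divide_distrib[symmetric])
        show "0 \<le> - t / (1 - t)" using t by (intro divide_nonneg_pos) auto
      qed (use t in auto)
      moreover have "?z = (1 / (1 - t)) *\<^sub>R w"
        using t by (simp add: scaleR_add_right)
      ultimately show False using disj subspace_scale[OF W wt(2)] by metis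
    qed
    have "convex {x. 0 < g x}"
      using convex_linear_vimage[OF g(1), of "{0<..}"] by (simp add: vimage_def)
    then have "convex hull S \<subseteq> {x. 0 < g x}" using g(3) by (intro hull_minimal) auto
    with wt(1) have "0 < g (w + t *\<^sub>R v)" by auto
    also have "\<dots> = t * g v"
      using g(2)[OF wt(2)] by (simp add: linear_add[OF g(1)] linear_cmul[OF g(1)])
    finally have "0 < g v" using \<open>0 < t\<close> by (simp add: zero_less_mult_iff)
    with g show ?thesis by auto
  qed
qed

text \<open>This is a form of the fact that faces of polytopes are exposed. Only finitely many points \<open>X\<close> matter here, so it suffices to
  separate the points of \<open>X\<close> outside the face from the affine hull of the face, whose
  direction space is \<open>W\<close>. If the affine hull contained a point \<open>p = u + c * (a - b)\<close> of \<open>Q - T\<close> with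
  \<open>u\<close>, \<open>a\<close>, \<open>b\<close> in \<open>T\<close>, then \<open>(u + c * a) / (1 + c) = (p + c * b) / (1 + c)\<close> would be a
  point of \<open>T\<close> inside the segment from \<open>p\<close> to \<open>b\<close>, forcing \<open>p\<close> into the face.\<close>

lemma face_supporting_functional:
  fixes Q :: "'a::real_vector set"
  assumes Q: "convex Q" and T: "T face_of Q" and X: "finite X" "X \<subseteq> Q"
  shows "\<exists>(g::'a \<Rightarrow> real) b. linear g \<and> (\<forall>x\<in>X \<inter> T. g x = b) \<and> (\<forall>x\<in>X - T. g x < b)"
proof (cases "X \<inter> T = {}")
  case True
  then show ?thesis by (intro exI[of _ "\<lambda>_. 0"] exI[of _ 1]) (auto simp: linear_zero)
next
  case False
  then obtain u where u: "u \<in> X" "u \<in> T" by blast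
  have cT: "convex T" and TQ: "T \<subseteq> Q" using T by (auto simp: face_of_def)
  define W where "W = {c *\<^sub>R (a - b) |a b c. a \<in> T \<and> b \<in> T \<and> (0::real) \<le> c}"
  have W: "subspace W"
  proof (rule subspaceI)
    show "0 \<in> W" unfolding W_def using u by force
    fix x y assume "x \<in> W" "y \<in> W"
    then obtain a b c a' b' c' where xy: "x = c *\<^sub>R (a - b)" "y = c' *\<^sub>R (a' - b')"
      and T: "a \<in> T" "b \<in> T" "a' \<in> T" "b' \<in> T" and c: "0 \<le> c" "0 \<le> c'"
      unfolding W_def by auto
    show "x + y \<in> W"
    proof (cases "c + c' = 0")
      case True
      then have "x + y = 0" using c xy by (simp add: add_nonneg_eq_0_iff)
      then show ?thesis unfolding W_def using u by force
    next
      case False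
      let ?m = "\<lambda>p q. (c / (c + c')) *\<^sub>R p + (c' / (c + c')) *\<^sub>R q"
      have "?m a a' \<in> T" "?m b b' \<in> T"
        using False c T by (auto intro!: convexD[OF cT] simp: divide_simps)
      moreover have m: "(c + c') *\<^sub>R ?m p q = c *\<^sub>R p + c' *\<^sub>R q" for p q :: 'a
        using False by (simp add: scaleR_add_right)
      have "x + y = (c + c') *\<^sub>R (?m a a' - ?m b b')"
        unfolding xy scaleR_diff_right m by (simp add: algebra_simps)
      ultimately show ?thesis unfolding W_def using c add_nonneg_nonneg by blast
    qed
  next
    fix r x assume "x \<in> W"
    then obtain a b c where x: "x = c *\<^sub>R (a - b)" "a \<in> T" "b \<in> T" "0 \<le> c" unfolding W_def by auto
    show "r *\<^sub>R x \<in> W"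
    proof (cases "0 \<le> r")
      case True
      then have "r *\<^sub>R x = (r * c) *\<^sub>R (a - b)" "0 \<le> r * c" unfolding x(1) using x(4) by auto
      then show ?thesis unfolding W_def using x by blast
    next
      case False
      then have "r *\<^sub>R x = (- r * c) *\<^sub>R (b - a)" "0 \<le> - r * c" unfolding x(1) using x(4)
        by (auto simp: algebra_simps mult_nonneg_nonpos)
      then show ?thesis unfolding W_def using x by blast
    qed
  qed
  have "convex hull ((\<lambda>x. u - x) ` (X - T)) \<inter> W = {}"
  proof (rule ccontr)
    assume "convex hull ((\<lambda>x. u - x) ` (X - T)) \<inter> W \<noteq> {}"
    then obtain w where w: "w \<in> convex hull ((\<lambda>x. u - x) ` (X - T))" "w \<in> W" by blast
    have conv: "convex (Q - T)"
      unfolding convex_contains_segment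
    proof (intro ballI subsetI)
      fix x y z assume xyz: "x \<in> Q - T" "y \<in> Q - T" "z \<in> closed_segment x y"
      then have "z \<in> Q" using Q unfolding convex_contains_segment by blast
      moreover have "z \<notin> T"
        using xyz T unfolding face_of_def open_segment_def by blast
      ultimately show "z \<in> Q - T" by blast
    qed
    have "convex hull ((\<lambda>x. u - x) ` (X - T)) \<subseteq> (\<lambda>x. u - x) ` (Q - T)"
    proof (rule hull_minimal)
      have "(\<lambda>x. u - x) ` (Q - T) = (\<lambda>x. u + x) ` uminus ` (Q - T)" by (simp add: image_image)
      then show "convex ((\<lambda>x. u - x) ` (Q - T))"
        by (simp only: convex_translation_eq convex_negations[OF conv])
    qed (use X in auto)
    with w(1) obtain p where p: "p \<in> Q" "p \<notin> T" "w = u - p" by auto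
    from subspace_neg[OF W w(2)] obtain a b c where abc: "p - u = c *\<^sub>R (a - b)" "a \<in> T" "b \<in> T" "0 \<le> c"
      unfolding p(3) W_def by auto
    have c: "0 < c" using abc p(2) u(2) by (cases "c = 0") auto
    define q where "q = (1 / (1 + c)) *\<^sub>R u + (c / (1 + c)) *\<^sub>R a"
    have "q \<in> T" unfolding q_def using c abc u by (intro convexD[OF cT]) (auto simp: divide_simps)
    have "q = (1 / (1 + c)) *\<^sub>R (p + c *\<^sub>R b)"
      using abc(1) unfolding q_def by (simp add: algebra_simps)
    then have "q = (1 - c / (1 + c)) *\<^sub>R p + (c / (1 + c)) *\<^sub>R b"
      using c by (simp add: scaleR_add_right field_simps)
    moreover have "p \<noteq> b" using p abc by blast
    ultimately have "q \<in> open_segment p b"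
      using c unfolding in_segment by (auto intro!: exI[of _ "c / (1 + c)"])
    with T \<open>q \<in> T\<close> p abc TQ have "p \<in> T" unfolding face_of_def by blast
    with p show False by blast
  qed
  from separating_functional_modulo_subspace[OF _ W this] X(1)
  obtain g :: "'a \<Rightarrow> real" where g: "linear g" "\<And>w. w \<in> W \<Longrightarrow> g w = 0" "\<And>x. x \<in> X - T \<Longrightarrow> 0 < g (u - x)"
    by auto
  show ?thesis
  proof (intro exI[of _ g] exI[of _ "g u"] conjI ballI)
    show "g x = g u" if "x \<in> X \<inter> T" for x
    proof -
      have "x - u = 1 *\<^sub>R (x - u)" by simp
      then have "x - u \<in> W" unfolding W_def using that u by (intro CollectI exI[of _ x] exI[of _ u] exI[of _ 1]) auto
      then show ?thesis using g(2)[of "x - u"] by (simp add: linear_diff[OF g(1)])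
    qed
    show "g x < g u" if "x \<in> X - T" for x
      using g(3)[OF that] by (simp add: linear_diff[OF g(1)])
  qed (rule g(1))
qed

section \<open>Edges of the cube\<close>

definition toggle :: "nat \<Rightarrow> (nat \<Rightarrow> nat) \<Rightarrow> nat \<Rightarrow> nat" where
  "toggle i v = v(i := 1 - v i)"

lemma cube_val: "v \<in> cube n \<Longrightarrow> i < n \<Longrightarrow> v i = 0 \<or> v i = 1"
  by (auto simp: cube_def)

lemma toggle_in_cube: "v \<in> cube n \<Longrightarrow> i < n \<Longrightarrow> toggle i v \<in> cube n"
  by (auto simp: cube_def toggle_def PiE_iff extensional_def)

lemma toggle_apply: "toggle i v j = (if j = i then 1 - v i else v j)"
  by (simp add: toggle_def)

lemma cube_adj_iff_toggle:
  "cube_adj n v w \<longleftrightarrow> v \<in> cube n \<and> (\<exists>i<n. w = toggle i v)"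
proof
  assume "cube_adj n v w"
  then obtain i where v: "v \<in> cube n" and w: "w \<in> cube n" and i: "i < n" "v i \<noteq> w i"
    and uniq: "\<And>j. j < n \<Longrightarrow> v j \<noteq> w j \<Longrightarrow> j = i"
    unfolding cube_adj_def by blast
  have "w j = toggle i v j" for j
  proof (cases "j < n")
    case True
    show ?thesis
    proof (cases "j = i")
      case True
      then show ?thesis using cube_val[OF v i(1)] cube_val[OF w i(1)] i(2) by (auto simp: toggle_apply)
    next
      case False
      then have "v j = w j" using uniq[OF True] by blast
      with False show ?thesis by (simp add: toggle_apply)
    qed
  next
    case False
    then show ?thesis using v w i by (auto simp: toggle_apply cube_def PiE_iff extensional_def)
  qed
  with v i show "v \<in> cube n \<and> (\<exists>i<n. w = toggle i v)" by blast
next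
  assume "v \<in> cube n \<and> (\<exists>i<n. w = toggle i v)"
  then obtain i where v: "v \<in> cube n" and i: "i < n" "w = toggle i v" by blast
  have "\<exists>!j. j < n \<and> v j \<noteq> w j"
    using i cube_val[OF v i(1)] by (intro ex1I[of _ i]) (auto simp: toggle_apply split: if_splits)
  then show "cube_adj n v w"
    unfolding cube_adj_def using toggle_in_cube[OF v i(1)] v i(2) by simp
qed

lemma finite_cube: "finite (cube n)"
  by (auto simp: cube_def intro: finite_PiE)

section \<open>Linearly inducible orientations are few\<close>

text \<open>Every permutation other than the identity moves at least two indices, so one of them differs
  from \<open>i\<close> and contributes a vanishing factor.\<close>

lemma det_diagonal_except_row:
  fixes M :: "'a::comm_ring_1 mat"
  assumes M: "M \<in> carrier_mat n n" and i: "i < n"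
    and off: "\<And>r c. r < n \<Longrightarrow> c < n \<Longrightarrow> r \<noteq> c \<Longrightarrow> r \<noteq> i \<Longrightarrow> M $$ (r, c) = 0"
  shows "Determinant.det M = M $$ (i, i) * (\<Prod>r\<in>{..<n} - {i}. M $$ (r, r))"
proof -
  have "(\<Prod>r = 0..<n. M $$ (r, p r)) = 0" if p: "p permutes {0..<n}" "p \<noteq> id" for p
  proof -
    have "\<exists>r<n. r \<noteq> i \<and> p r \<noteq> r"
    proof (rule ccontr)
      assume "\<not> ?thesis"
      then have "p permutes {i}"
        by (intro permutes_superset[OF p(1)]) auto
      then have "p = id" by simp
      with p(2) show False by simp
    qed
    then obtain r where r: "r < n" "r \<noteq> i" "p r \<noteq> r" by blast
    then have "p r < n" using permutes_in_image[OF p(1), of r] by simp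
    then have "M $$ (r, p r) = 0" using off[of r "p r"] r by auto
    then show ?thesis using r by (intro prod_zero) auto
  qed
  then have "Determinant.det M = (\<Sum>p\<in>{id}. signof p * (\<Prod>r = 0..<n. M $$ (r, p r)))"
    unfolding det_def'[OF M]
    by (intro sum.mono_neutral_right) (auto simp: finite_permutations permutes_id)
  also have "\<dots> = (\<Prod>r<n. M $$ (r, r))" by (simp add: atLeast0LessThan)
  also have "\<dots> = M $$ (i, i) * (\<Prod>r\<in>{..<n} - {i}. M $$ (r, r))"
    using i by (simp add: prod.remove)
  finally show ?thesis .
qed

lemma facet_in_cube_face_lattice:
  assumes "i < n" "\<epsilon> \<in> {0, 1}"
  shows "{v \<in> cube n. v i = \<epsilon>} \<in> cube_face_lattice n"
proof -
  let ?a = "\<lambda>j. if j < n then \<epsilon> else undefined"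
  have "?a \<in> cube n" using assms by (auto simp: cube_def PiE_iff extensional_def)
  moreover have "{v \<in> cube n. v i = \<epsilon>} = {x \<in> cube n. \<forall>j\<in>{..<n} - ({..<n} - {i}). x j = ?a j}"
    using assms by auto
  ultimately have "cube_face n (card ({..<n} - {i})) {v \<in> cube n. v i = \<epsilon>}"
    unfolding cube_face_def by blast
  then show ?thesis unfolding cube_face_lattice_def by blast
qed

lemma vertex_in_cube_face_lattice:
  assumes "v \<in> cube n"
  shows "{v} \<in> cube_face_lattice n"
proof -
  have "{v} = {x \<in> cube n. \<forall>j\<in>{..<n} - {}. x j = v j}"
    using assms by (auto simp: cube_def intro: PiE_ext)
  then have "cube_face n (card ({} :: nat set)) {v}"
    unfolding cube_face_def using assms by blast
  then show ?thesis unfolding cube_face_lattice_def by blast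
qed

lemma cube_realization_vertex:
  assumes R: "cube_realization n Q \<phi>" and v: "v \<in> cube n"
  shows "\<phi> v \<in> Q" "\<phi> v \<in> Rn n"
proof -
  from R obtain \<Phi> where \<Phi>: "bij_betw \<Phi> (cube_face_lattice n) {T. T face_of Q}"
    and "\<forall>v \<in> cube n. \<Phi> {v} = {\<phi> v}"
    unfolding cube_realization_def by (elim conjE exE)
  with v have "{\<phi> v} face_of Q"
    using bij_betw_apply[OF \<Phi> vertex_in_cube_face_lattice[OF v]] by simp
  then show "\<phi> v \<in> Q" using face_of_imp_subset by blast
  then show "\<phi> v \<in> Rn n" using R by (auto simp: cube_realization_def)
qed

text \<open>The functional is the one that supports the facet of \<open>Q\<close> corresponding to \<open>v i = \<epsilon>\<close>; a vertex
  lies on this facet if and only if it does so in the cube because \<open>\<Phi>\<close> preserves and reflects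
  inclusion.\<close>

lemma cube_realization_facet_functional:
  assumes R: "cube_realization n Q \<phi>" and i: "i < n" "\<epsilon> \<in> {0, 1}"
  shows "\<exists>(g :: (nat \<Rightarrow>\<^sub>0 real) \<Rightarrow> real) b. linear g \<and>
    (\<forall>v\<in>cube n. v i = \<epsilon> \<longrightarrow> g (\<phi> v) = b) \<and> (\<forall>v\<in>cube n. v i \<noteq> \<epsilon> \<longrightarrow> g (\<phi> v) < b)"
proof -
  from R obtain \<Phi> where \<Phi>: "bij_betw \<Phi> (cube_face_lattice n) {T. T face_of Q}"
    and "\<forall>F \<in> cube_face_lattice n. \<forall>G \<in> cube_face_lattice n. \<Phi> F \<subseteq> \<Phi> G \<longleftrightarrow> F \<subseteq> G"
    and "\<forall>v \<in> cube n. \<Phi> {v} = {\<phi> v}"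
    unfolding cube_realization_def by (elim conjE exE)
  note \<Phi> = \<Phi> this(2)[rule_format] this(3)[rule_format]
  have "polytope Q" using R by (simp add: cube_realization_def)
  then have Q: "convex Q" by (rule polytope_imp_convex)
  let ?F = "{v \<in> cube n. v i = \<epsilon>}"
  have F: "?F \<in> cube_face_lattice n" by (rule facet_in_cube_face_lattice[OF i])
  have face: "\<Phi> G face_of Q" if "G \<in> cube_face_lattice n" for G
    using bij_betw_apply[OF \<Phi>(1) that] by simp
  have "\<phi> ` cube n \<subseteq> Q"
    using cube_realization_vertex[OF R] by blast
  from face_supporting_functional[OF Q face[OF F] _ this] finite_cube
  obtain g b where g: "linear g" "\<forall>x\<in>\<phi> ` cube n \<inter> \<Phi> ?F. g x = b" "\<forall>x\<in>\<phi> ` cube n - \<Phi> ?F. g x < (b::real)"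
    by auto
  have "\<phi> v \<in> \<Phi> ?F \<longleftrightarrow> v i = \<epsilon>" if v: "v \<in> cube n" for v
    using \<Phi>(2)[OF vertex_in_cube_face_lattice[OF v] F] \<Phi>(3)[OF v] v by simp
  with g show ?thesis by (intro exI[of _ g] exI[of _ b]) auto
qed

lemma lookup_scaleR: "Poly_Mapping.lookup (c *\<^sub>R x) j = c *\<^sub>R Poly_Mapping.lookup (x :: 'a \<Rightarrow>\<^sub>0 real) j"
proof -
  have "finite {i. c *\<^sub>R Poly_Mapping.lookup x i \<noteq> 0}"
    by (rule finite_subset[OF _ finite_lookup[of x]]) auto
  then show ?thesis unfolding scaleR_poly_mapping_def by (simp add: Abs_poly_mapping_inverse)
qed

lemma linear_on_Rn:
  fixes g :: "(nat \<Rightarrow>\<^sub>0 real) \<Rightarrow> real"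
  assumes "linear g" "x \<in> Rn n"
  shows "g x = (\<Sum>j<n. g (Poly_Mapping.single j 1) * Poly_Mapping.lookup x j)"
proof -
  have "x = (\<Sum>j<n. Poly_Mapping.lookup x j *\<^sub>R Poly_Mapping.single j 1)"
  proof (rule poly_mapping_eqI)
    fix k
    have "Poly_Mapping.lookup (\<Sum>j<n. Poly_Mapping.lookup x j *\<^sub>R Poly_Mapping.single j 1) k =
        (\<Sum>j<n. if j = k then Poly_Mapping.lookup x j else 0)"
      unfolding lookup_sum by (intro sum.cong) (auto simp: lookup_scaleR lookup_single)
    also have "\<dots> = Poly_Mapping.lookup x k"
      using assms(2) by (auto simp: Rn_def in_keys_iff)
    finally show "Poly_Mapping.lookup x k =
      Poly_Mapping.lookup (\<Sum>j<n. Poly_Mapping.lookup x j *\<^sub>R Poly_Mapping.single j 1) k" by simp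
  qed
  then have "g x = g (\<Sum>j<n. Poly_Mapping.lookup x j *\<^sub>R Poly_Mapping.single j 1)" by simp
  also have "\<dots> = (\<Sum>j<n. g (Poly_Mapping.single j 1) * Poly_Mapping.lookup x j)"
    by (simp add: linear_sum[OF assms(1)] linear_cmul[OF assms(1)] mult.commute)
  finally show ?thesis .
qed

text \<open>The parameters are three \<open>n \<times> n\<close> tables \<open>x (\<epsilon>, i, j)\<close>, and \<open>w\<close> chooses for each row
  from which table it is taken. Tables \<open>0\<close> and \<open>1\<close> will hold the coefficients of the facet
  functionals; table \<open>2\<close> will have all its rows equal to the coefficients of the objective.\<close>

definition choice_matrix :: "nat \<Rightarrow> (nat \<Rightarrow> nat) \<Rightarrow> (nat \<times> nat \<times> nat \<Rightarrow> real) \<Rightarrow> real mat" where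
  "choice_matrix n w x = mat n n (\<lambda>(r, c). x (w r, r, c))"

definition choice_det :: "nat \<Rightarrow> (nat \<Rightarrow> nat) \<Rightarrow> (nat \<times> nat \<times> nat \<Rightarrow> real) \<Rightarrow> real" where
  "choice_det n w x = Determinant.det (choice_matrix n w x)"

lemma polyfun_choice_det:
  assumes "w \<in> {..<n} \<rightarrow>\<^sub>E {..<3}"
  shows "polyfun ({..<3} \<times> {..<n} \<times> {..<n}) n (choice_det n w)"
proof -
  have eq: "choice_det n w = (\<lambda>x. \<Sum>p | p permutes {0..<n}. signof p * (\<Prod>r = 0..<n. x (w r, r, p r)))"
  proof
    fix x
    have "(\<Prod>r = 0..<n. choice_matrix n w x $$ (r, p r)) = (\<Prod>r = 0..<n. x (w r, r, p r))"
      if "p permutes {0..<n}" for p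
      using permutes_in_image[OF that] by (intro prod.cong) (auto simp: choice_matrix_def)
    then show "choice_det n w x = (\<Sum>p | p permutes {0..<n}. signof p * (\<Prod>r = 0..<n. x (w r, r, p r)))"
      unfolding choice_det_def by (subst det_def'[where n = n]) (auto simp: choice_matrix_def)
  qed
  show ?thesis
    unfolding eq
  proof (intro polyfun_sum polyfun_cmult)
    fix p assume "p \<in> {p. p permutes {0..<n}}"
    then have p: "p permutes {0..<n}" by simp
    have "polyfun ({..<3} \<times> {..<n} \<times> {..<n}) (card {0..<n} * Suc 0) (\<lambda>x. \<Prod>r = 0..<n. x (w r, r, p r))"
      by (intro polyfun_prod polyfun_var) (use assms permutes_in_image[OF p] in auto)
    then show "polyfun ({..<3} \<times> {..<n} \<times> {..<n}) n (\<lambda>x. \<Prod>r = 0..<n. x (w r, r, p r))" by simp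
  qed
qed

text \<open>Let \<open>E\<close> be the matrix whose columns are the edge vectors at \<open>v\<close>. The edge in direction \<open>c\<close> leaves
  the facet of direction \<open>c\<close> through \<open>v\<close> and stays on those of all other directions, so the matrix of
  these facet functionals times \<open>E\<close> is diagonal with negative entries \<open>\<delta> r\<close>. Replacing row \<open>i\<close> by the
  objective changes the determinant of the product only through the \<open>i\<close>-th diagonal entry, which
  becomes the change of the objective along the edge in direction \<open>i\<close>; the ratio of the two determinants is the ratio of these entries. In particular, both
  determinants are nonzero; their signs agree if and only if the objective decreases.\<close>

lemma edge_direction_by_determinants:
  assumes R: "cube_realization n Q \<phi>" and f: "linear (f :: (nat \<Rightarrow>\<^sub>0 real) \<Rightarrow> real)"
  shows "\<exists>x. \<forall>v\<in>cube n. \<forall>i<n. f (\<phi> v) \<noteq> f (\<phi> (toggle i v)) \<longrightarrow>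
    choice_det n v x \<noteq> 0 \<and> choice_det n (v(i := 2)) x \<noteq> 0 \<and>
    (f (\<phi> v) < f (\<phi> (toggle i v)) \<longleftrightarrow> (0 < choice_det n v x) \<noteq> (0 < choice_det n (v(i := 2)) x))"
proof -
  define facet where "facet \<epsilon> i = (\<lambda>(g :: (nat \<Rightarrow>\<^sub>0 real) \<Rightarrow> real, b). linear g \<and>
    (\<forall>v\<in>cube n. v i = \<epsilon> \<longrightarrow> g (\<phi> v) = b) \<and> (\<forall>v\<in>cube n. v i \<noteq> \<epsilon> \<longrightarrow> g (\<phi> v) < b))" for \<epsilon> i
  define g where "g \<epsilon> i = fst (SOME p. facet \<epsilon> i p)" for \<epsilon> i
  define b where "b \<epsilon> i = snd (SOME p. facet \<epsilon> i p)" for \<epsilon> i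
  have facet: "facet \<epsilon> i (g \<epsilon> i, b \<epsilon> i)" if i: "i < n" "\<epsilon> \<in> {0, 1}" for \<epsilon> i
  proof -
    have "\<exists>p. facet \<epsilon> i p"
      using cube_realization_facet_functional[OF R i] unfolding facet_def by simp
    then show ?thesis unfolding g_def b_def prod.collapse by (rule someI_ex)
  qed
  have g: "linear (g \<epsilon> i)" "v \<in> cube n \<Longrightarrow> v i = \<epsilon> \<Longrightarrow> g \<epsilon> i (\<phi> v) = b \<epsilon> i"
    "v \<in> cube n \<Longrightarrow> v i \<noteq> \<epsilon> \<Longrightarrow> g \<epsilon> i (\<phi> v) < b \<epsilon> i" if "i < n" "\<epsilon> \<in> {0, 1}" for \<epsilon> i v
    using facet[OF that] by (simp_all add: facet_def)
  define G where "G \<epsilon> i = (if \<epsilon> = 2 then f else g \<epsilon> i)" for \<epsilon> i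
  define x where "x = (\<lambda>(\<epsilon>, i, j). G \<epsilon> i (Poly_Mapping.single j 1))"
  note Rn = cube_realization_vertex(2)[OF R]
  show ?thesis
  proof (intro exI[of _ x] ballI allI impI)
    fix v i assume v: "v \<in> cube n" and i: "i < n" and ne: "f (\<phi> v) \<noteq> f (\<phi> (toggle i v))"
    define E where "E = mat n n (\<lambda>(j, c). Poly_Mapping.lookup (\<phi> (toggle c v)) j - Poly_Mapping.lookup (\<phi> v) j)"
    have prod_entry: "(choice_matrix n w x * E) $$ (r, c) = G (w r) r (\<phi> (toggle c v)) - G (w r) r (\<phi> v)"
      if "r < n" "c < n" "linear (G (w r) r)" for w r c
      using that linear_on_Rn[OF that(3) Rn[OF v]] linear_on_Rn[OF that(3) Rn[OF toggle_in_cube[OF v \<open>c < n\<close>]]]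
      by (simp add: choice_matrix_def E_def scalar_prod_def x_def atLeast0LessThan right_diff_distrib sum_subtractf)
    have vr: "v r \<in> {0, 1}" "v r \<noteq> 2" if "r < n" for r using cube_val[OF v that] by auto
    have Gv: "G (v r) r = g (v r) r" if "r < n" for r using vr[OF that] by (simp add: G_def)
    have off: "g (v r) r (\<phi> (toggle c v)) - g (v r) r (\<phi> v) = 0" if "r < n" "c < n" "r \<noteq> c" for r c
      using g(2)[OF \<open>r < n\<close> vr(1)[OF \<open>r < n\<close>], of "toggle c v"] g(2)[OF \<open>r < n\<close> vr(1)[OF \<open>r < n\<close>], of v]
        v toggle_in_cube[OF v] that by (simp add: toggle_apply)
    define \<delta> where "\<delta> r = g (v r) r (\<phi> (toggle r v)) - g (v r) r (\<phi> v)" for r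
    have \<delta>: "\<delta> r < 0" if "r < n" for r
      using g(3)[OF that vr(1)[OF that], of "toggle r v"] g(2)[OF that vr(1)[OF that], of v]
        v toggle_in_cube[OF v that] vr[OF that] by (auto simp: toggle_apply \<delta>_def)
    have carr: "choice_matrix n w x \<in> carrier_mat n n" "E \<in> carrier_mat n n" for w
      by (auto simp: choice_matrix_def E_def)
    define \<pi> where "\<pi> = (\<Prod>r\<in>{..<n} - {i}. \<delta> r)"
    have "choice_det n w x * Determinant.det E = d * \<pi>"
      if w: "\<And>r. r < n \<Longrightarrow> r \<noteq> i \<Longrightarrow> w r = v r" and lin: "linear (G (w i) i)"
        and d: "d = G (w i) i (\<phi> (toggle i v)) - G (w i) i (\<phi> v)" for w d
    proof -
      have M: "choice_matrix n w x * E \<in> carrier_mat n n" by (rule mult_carrier_mat[OF carr])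
      have entry: "(choice_matrix n w x * E) $$ (r, c) = g (v r) r (\<phi> (toggle c v)) - g (v r) r (\<phi> v)"
        if "r < n" "c < n" "r \<noteq> i" for r c
        using prod_entry[where w = w, OF that(1,2)] w[OF that(1,3)] Gv[OF that(1)]
          g(1)[OF that(1) vr(1)[OF that(1)]] by simp
      have "Determinant.det (choice_matrix n w x * E) =
          (choice_matrix n w x * E) $$ (i, i) * (\<Prod>r\<in>{..<n} - {i}. (choice_matrix n w x * E) $$ (r, r))"
        by (rule det_diagonal_except_row[OF M i]) (simp add: entry off)
      also have "(choice_matrix n w x * E) $$ (i, i) = d"
        using prod_entry[where w = w, OF i i lin] d by simp
      also have "(\<Prod>r\<in>{..<n} - {i}. (choice_matrix n w x * E) $$ (r, r)) = \<pi>"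
        unfolding \<pi>_def \<delta>_def by (intro prod.cong refl) (simp add: entry)
      finally show ?thesis unfolding choice_det_def det_mult[OF carr, symmetric] .
    qed
    from this[of v "\<delta> i"] this[of "v(i := 2)" "f (\<phi> (toggle i v)) - f (\<phi> v)"]
    have "choice_det n v x * Determinant.det E = \<delta> i * \<pi>"
      "choice_det n (v(i := 2)) x * Determinant.det E = (f (\<phi> (toggle i v)) - f (\<phi> v)) * \<pi>"
      using g(1)[OF i vr(1)[OF i]] f Gv[OF i] by (simp_all add: \<delta>_def G_def)
    moreover have "\<pi> \<noteq> 0" unfolding \<pi>_def using \<delta> by (auto simp: less_le)
    ultimately have *: "choice_det n v x * Determinant.det E = \<delta> i * \<pi>"
      "choice_det n (v(i := 2)) x * Determinant.det E = (f (\<phi> (toggle i v)) - f (\<phi> v)) * \<pi>" "\<pi> \<noteq> 0"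
      by auto
    define a where "a = choice_det n v x"
    define a' where "a' = choice_det n (v(i := 2)) x"
    define y where "y = f (\<phi> (toggle i v)) - f (\<phi> v)"
    have y: "y \<noteq> 0" using ne by (simp add: y_def)
    have "a * Determinant.det E \<noteq> 0" "a' * Determinant.det E \<noteq> 0"
      using * y \<delta>[OF i] by (auto simp: a_def a'_def y_def)
    then have nz: "a \<noteq> 0" "a' \<noteq> 0" by auto
    have "a' * \<delta> i * (Determinant.det E * \<pi>) = a * y * (Determinant.det E * \<pi>)"
      using * unfolding a_def a'_def y_def by (simp add: mult.commute mult.left_commute)
    moreover have "Determinant.det E * \<pi> \<noteq> 0" using \<open>a * Determinant.det E \<noteq> 0\<close> *(3) by auto
    ultimately have eq: "a' * \<delta> i = a * y" by simp
    have "0 < y \<longleftrightarrow> (0 < a) \<noteq> (0 < a')"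
    proof -
      have "0 < a' * \<delta> i \<longleftrightarrow> a' < 0" using \<delta>[OF i] by (simp add: zero_less_mult_iff)
      moreover have "0 < a * y \<longleftrightarrow> (0 < a \<and> 0 < y \<or> a < 0 \<and> y < 0)" by (simp add: zero_less_mult_iff)
      ultimately show ?thesis using eq nz y by (smt (verit))
    qed
    with nz show "choice_det n v x \<noteq> 0 \<and> choice_det n (v(i := 2)) x \<noteq> 0 \<and>
      (f (\<phi> v) < f (\<phi> (toggle i v)) \<longleftrightarrow> (0 < choice_det n v x) \<noteq> (0 < choice_det n (v(i := 2)) x))"
      by (simp add: a_def a'_def y_def)
  qed
qed

text \<open>The map \<open>decode\<close> recovers the orientation from the set of choices \<open>w\<close> with positive determinant.
  The relevant choices are the vertices \<open>v\<close> and the \<open>v(i := 2)\<close>; as functions into \<open>{..<3}\<close> they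
  number at most \<open>3 ^ n\<close>.\<close>

lemma card_lp_orientations_le:
  "card {D. lp_orientation n D} \<le> (3 * n\<^sup>2 * (3 * (3 ^ n * n) + 1) + 1) ^ (3 * n\<^sup>2)"
proof -
  define V where "V = {..<3::nat} \<times> {..<n} \<times> {..<n}"
  define J where "J = cube n \<union> {v(i := 2) |v i. v \<in> cube n \<and> i < n}"
  define S where "S = {{w \<in> J. 0 < choice_det n w x} |x. \<forall>w\<in>J. choice_det n w x \<noteq> 0}"
  define decode where "decode T = {(v, toggle i v) |v i. v \<in> cube n \<and> i < n \<and>
    (v \<in> T) \<noteq> (v(i := 2) \<in> T)}" for T
  have J: "J \<subseteq> {..<n} \<rightarrow>\<^sub>E {..<3}"
  proof
    fix w assume "w \<in> J"
    then consider "w \<in> cube n" | v i where "v \<in> cube n" "i < n" "w = v(i := 2)"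
      unfolding J_def by blast
    then show "w \<in> {..<n} \<rightarrow>\<^sub>E {..<3}"
      by cases (auto simp: cube_def PiE_iff extensional_def Ball_def)
  qed
  have finJ: "finite J" by (rule finite_subset[OF J]) (auto intro: finite_PiE)
  have "card J \<le> card ({..<n} \<rightarrow>\<^sub>E {..<3::nat})" by (rule card_mono[OF _ J]) (auto intro: finite_PiE)
  then have cJ: "card J \<le> 3 ^ n" by (simp add: card_PiE)
  have cV: "card V = 3 * n\<^sup>2" by (simp add: V_def card_cartesian_product power2_eq_square)
  have "{D. lp_orientation n D} \<subseteq> decode ` S"
  proof
    fix D assume "D \<in> {D. lp_orientation n D}"
    then obtain Q \<phi> f where D: "cube_orientation n D" and R: "cube_realization n Q \<phi>"
      and f: "linear (f :: (nat \<Rightarrow>\<^sub>0 real) \<Rightarrow> real)"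
      and ne: "\<And>v w. cube_adj n v w \<Longrightarrow> f (\<phi> v) \<noteq> f (\<phi> w)"
      and dir: "\<And>v w. cube_adj n v w \<Longrightarrow> (v, w) \<in> D \<longleftrightarrow> f (\<phi> v) < f (\<phi> w)"
      unfolding lp_orientation_def by blast
    obtain x where x: "\<And>v i. v \<in> cube n \<Longrightarrow> i < n \<Longrightarrow> f (\<phi> v) \<noteq> f (\<phi> (toggle i v)) \<Longrightarrow>
      choice_det n v x \<noteq> 0 \<and> choice_det n (v(i := 2)) x \<noteq> 0 \<and>
      (f (\<phi> v) < f (\<phi> (toggle i v)) \<longleftrightarrow> (0 < choice_det n v x) \<noteq> (0 < choice_det n (v(i := 2)) x))"
      using edge_direction_by_determinants[OF R f] by blast
    have adj: "cube_adj n v (toggle i v)" if "v \<in> cube n" "i < n" for v i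
      using that by (auto simp: cube_adj_iff_toggle)
    define T where "T = {w \<in> J. 0 < choice_det n w x}"
    have "D = decode T"
    proof (rule equalityI; rule subsetI)
      fix e assume e: "e \<in> D"
      obtain v w where vw: "e = (v, w)" by (cases e)
      with e D have "cube_adj n v w" by (auto simp: cube_orientation_def)
      then obtain i where i: "v \<in> cube n" "i < n" "w = toggle i v" by (auto simp: cube_adj_iff_toggle)
      then have "f (\<phi> v) < f (\<phi> (toggle i v))" using e vw dir adj by blast
      then have "(v \<in> T) \<noteq> (v(i := 2) \<in> T)"
        using x[OF i(1,2)] ne[OF adj[OF i(1,2)]] i by (auto simp: T_def J_def)
      then show "e \<in> decode T" using i vw by (auto simp: decode_def)
    next
      fix e assume "e \<in> decode T"
      then obtain v i where i: "e = (v, toggle i v)" "v \<in> cube n" "i < n" "(v \<in> T) \<noteq> (v(i := 2) \<in> T)"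
        by (auto simp: decode_def)
      moreover have "v \<in> J" "v(i := 2) \<in> J" using i by (auto simp: J_def)
      ultimately have "f (\<phi> v) < f (\<phi> (toggle i v))"
        using x[OF i(2,3)] ne[OF adj[OF i(2,3)]] by (auto simp: T_def)
      then show "e \<in> D" using dir[OF adj[OF i(2,3)]] i by blast
    qed
    moreover have "T \<in> S"
    proof -
      have "choice_det n w x \<noteq> 0" if "w \<in> J" for w
      proof -
        consider "w \<in> cube n" "n = 0" | i where "w \<in> cube n" "i < n"
          | v i where "v \<in> cube n" "i < n" "w = v(i := 2)"
          using \<open>w \<in> J\<close> unfolding J_def by blast
        then show ?thesis
        proof cases
          case 1
          then show ?thesis by (simp add: choice_det_def choice_matrix_def)
        next
          case 2
          then show ?thesis using x ne[OF adj] by blast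
        next
          case 3
          then show ?thesis using x ne[OF adj] by blast
        qed
      qed
      then show ?thesis unfolding S_def T_def by blast
    qed
    ultimately show "D \<in> decode ` S" by blast
  qed
  moreover have "finite S" by (rule finite_subset[of _ "Pow J"]) (auto simp: S_def finJ)
  ultimately have "card {D. lp_orientation n D} \<le> card S"
    using surj_card_le by blast
  also have "card S \<le> (card V * (3 * (card J * n) + 1) + 1) ^ card V"
    unfolding S_def
  proof (rule card_sign_patterns_le)
    show "finite V" "finite J" by (auto simp: V_def finJ)
    show "polyfun V n (choice_det n w)" if "w \<in> J" for w
      using polyfun_choice_det J that unfolding V_def by blast
  qed
  also have "\<dots> \<le> (3 * n\<^sup>2 * (3 * (3 ^ n * n) + 1) + 1) ^ (3 * n\<^sup>2)"
    unfolding cV using cJ by (intro power_mono add_mono mult_mono) auto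
  finally show ?thesis .
qed

section \<open>Holt-Klee orientations are many\<close>

definition subcube :: "nat \<Rightarrow> nat set \<Rightarrow> (nat \<Rightarrow> nat) \<Rightarrow> (nat \<Rightarrow> nat) set" where
  "subcube n I a = {x \<in> cube n. \<forall>i\<in>{..<n} - I. x i = a i}"

lemma toggle_toggle: "v \<in> cube n \<Longrightarrow> i < n \<Longrightarrow> toggle i (toggle i v) = v"
  using cube_val[of v n i] by (auto simp: toggle_def fun_eq_iff)

lemma toggle_eq_iff: "toggle i v = toggle j v \<longleftrightarrow> i = j"
proof
  assume "toggle i v = toggle j v"
  then have "toggle i v i = toggle j v i" by simp
  moreover have "1 - v i \<noteq> v i" by arith
  ultimately show "i = j" by (simp add: toggle_apply split: if_splits)
qed simp

lemma toggle_in_subcube_iff: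
  assumes "x \<in> subcube n I a" "i < n"
  shows "toggle i x \<in> subcube n I a \<longleftrightarrow> i \<in> I"
proof -
  have "Suc 0 - y \<noteq> y" for y by arith
  then show ?thesis
    using assms toggle_in_cube[of x n i] by (auto simp: subcube_def toggle_apply)
qed

text \<open>Direction \<open>0\<close> is the special one: its edges are directed upwards over the points of \<open>U\<close> and downwards elsewhere, and
  points of the \<open>(n - 1)\<close>-cube are represented by vertices with coordinate \<open>0\<close> equal to \<open>0\<close>.\<close>

definition outgoing :: "(nat \<Rightarrow> nat) set \<Rightarrow> (nat \<Rightarrow> nat) \<Rightarrow> nat \<Rightarrow> bool" where
  "outgoing U v i \<longleftrightarrow> (if i = 0 then (v 0 = 0) = (v(0 := 0) \<in> U) else v i = 0)"

definition twisted_orientation :: "nat \<Rightarrow> (nat \<Rightarrow> nat) set \<Rightarrow> digraph" where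
  "twisted_orientation n U = {(v, toggle i v) |v i. v \<in> cube n \<and> i < n \<and> outgoing U v i}"

lemma twisted_orientation_iff:
  "(v, w) \<in> twisted_orientation n U \<longleftrightarrow> v \<in> cube n \<and> (\<exists>i<n. w = toggle i v \<and> outgoing U v i)"
  by (auto simp: twisted_orientation_def)

lemma outgoing_toggle:
  assumes "v \<in> cube n" "i < n"
  shows "outgoing U (toggle i v) i \<longleftrightarrow> \<not> outgoing U v i"
  using cube_val[OF assms] by (auto simp: outgoing_def toggle_def)

lemma cube_orientation_twisted: "cube_orientation n (twisted_orientation n U)"
  unfolding cube_orientation_def
proof (intro conjI allI impI)
  show "twisted_orientation n U \<subseteq> {(v, w). cube_adj n v w}"
    by (auto simp: twisted_orientation_iff cube_adj_iff_toggle)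
  fix v w assume "cube_adj n v w"
  then obtain i where i: "v \<in> cube n" "i < n" "w = toggle i v" by (auto simp: cube_adj_iff_toggle)
  have "(v, w) \<in> twisted_orientation n U \<longleftrightarrow> outgoing U v i"
    using i by (auto simp: twisted_orientation_iff toggle_eq_iff)
  moreover have "v = toggle j w \<longleftrightarrow> j = i" for j
    using toggle_toggle[OF i(1,2)] toggle_eq_iff[of j w i] i(3) by auto
  then have "(w, v) \<in> twisted_orientation n U \<longleftrightarrow> outgoing U w i"
    using i toggle_in_cube[OF i(1,2)] by (auto simp: twisted_orientation_iff)
  ultimately show "(v, w) \<in> twisted_orientation n U \<longleftrightarrow> (w, v) \<notin> twisted_orientation n U"
    using outgoing_toggle[OF i(1,2)] i(3) by simp
qed

text \<open>Edges in directions other than \<open>0\<close> raise the weight of the remaining coordinates, and edges in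
  direction \<open>0\<close> keep it. Doubling the weight leaves room for a bit that records on which side of the
  edge in direction \<open>0\<close> the vertex lies.\<close>

lemma acyclic_twisted_orientation:
  assumes "0 < n"
  shows "acyclic (twisted_orientation n U)"
proof -
  define wt where "wt v = (\<Sum>i\<in>{1..<n}. v i)" for v :: "nat \<Rightarrow> nat"
  define \<psi> where "\<psi> v = 2 * wt v + (if outgoing U v 0 then 0 else 1)" for v
  have "\<psi> v < \<psi> (toggle i v)" if v: "v \<in> cube n" and i: "i < n" "outgoing U v i" for v i
  proof (cases "i = 0")
    case True
    have "wt (toggle i v) = wt v"
      unfolding wt_def by (intro sum.cong) (auto simp: toggle_apply True)
    then show ?thesis using outgoing_toggle[OF v i(1), of U] i True by (simp add: \<psi>_def)
  next
    case False
    then have vi: "v i = 0" using i by (simp add: outgoing_def)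
    have mem: "i \<in> {1..<n}" using i False by simp
    have "(\<Sum>j\<in>{1..<n} - {i}. toggle i v j) = (\<Sum>j\<in>{1..<n} - {i}. v j)"
      by (intro sum.cong) (auto simp: toggle_apply)
    then have "wt (toggle i v) = Suc (wt v)"
      unfolding wt_def using sum.remove[OF _ mem, of v] sum.remove[OF _ mem, of "toggle i v"] vi
      by (simp add: toggle_apply)
    then show ?thesis by (simp add: \<psi>_def)
  qed
  then have "twisted_orientation n U \<subseteq> Wellfounded.measure \<psi>" by (auto simp: twisted_orientation_iff)
  then show ?thesis using acyclic_subset wf_acyclic wf_measure by metis
qed

lemma is_source_twisted_iff:
  assumes I: "I \<subseteq> {..<n}"
  shows "is_source (twisted_orientation n U) (subcube n I a) s \<longleftrightarrow>
    s \<in> subcube n I a \<and> (\<forall>i\<in>I. outgoing U s i)"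
proof (cases "s \<in> subcube n I a")
  case s: True
  then have sc: "s \<in> cube n" by (simp add: subcube_def)
  show ?thesis
  proof (intro iffI conjI ballI s)
    fix i assume src: "is_source (twisted_orientation n U) (subcube n I a) s" and i: "i \<in> I"
    then have n: "i < n" using I by auto
    have "toggle i s \<in> subcube n I a" using toggle_in_subcube_iff[OF s n] i by simp
    then have "(toggle i s, s) \<notin> twisted_orientation n U" using src by (simp add: is_source_def)
    then have "\<not> outgoing U (toggle i s) i"
      using n toggle_in_cube[OF sc n] toggle_toggle[OF sc n] by (auto simp: twisted_orientation_iff)
    then show "outgoing U s i" using outgoing_toggle[OF sc n] by simp
  next
    assume out: "s \<in> subcube n I a \<and> (\<forall>i\<in>I. outgoing U s i)"
    show "is_source (twisted_orientation n U) (subcube n I a) s"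
      unfolding is_source_def
    proof (intro conjI ballI notI s)
      fix u assume u: "u \<in> subcube n I a" "(u, s) \<in> twisted_orientation n U"
      then obtain i where i: "i < n" "s = toggle i u" "outgoing U u i" "u \<in> cube n"
        by (auto simp: twisted_orientation_iff)
      then have "i \<in> I" using toggle_in_subcube_iff[OF u(1) i(1)] s by simp
      with out outgoing_toggle[OF i(4,1), of U] i show False by auto
    qed
  qed
qed (auto simp: is_source_def)

lemma is_sink_twisted_iff:
  assumes I: "I \<subseteq> {..<n}"
  shows "is_sink (twisted_orientation n U) (subcube n I a) t \<longleftrightarrow>
    t \<in> subcube n I a \<and> (\<forall>i\<in>I. \<not> outgoing U t i)"
proof (cases "t \<in> subcube n I a")
  case t: True
  then have tc: "t \<in> cube n" by (simp add: subcube_def)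
  have "(\<forall>u\<in>subcube n I a. (t, u) \<notin> twisted_orientation n U) \<longleftrightarrow> (\<forall>i\<in>I. \<not> outgoing U t i)"
    using I tc toggle_in_subcube_iff[OF t] by (auto simp: twisted_orientation_iff subset_iff)
  then show ?thesis using t by (simp add: is_sink_def)
qed (auto simp: is_sink_def)

text \<open>Sources (\<open>c = True\<close>) and sinks (\<open>c = False\<close>) of a face at once: the requirement determines the
  free coordinates other than \<open>0\<close>, and with them the point of the \<open>(n - 1)\<close>-cube whose membership in
  \<open>U\<close> decides coordinate \<open>0\<close>.\<close>

lemma ex1_constant_outgoing:
  assumes I: "I \<subseteq> {..<n}" and a: "a \<in> cube n"
  shows "\<exists>!s. s \<in> subcube n I a \<and> (\<forall>i\<in>I. outgoing U s i \<longleftrightarrow> c)"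
proof (rule ex_ex1I)
  define m where "m i = (if i \<in> I then (if c then 0 else 1) else a i)" for i :: nat
  define b :: nat where "b = (if (m(0 := 0) \<in> U) = c then 0 else 1)"
  define s where "s i = (if i = 0 \<and> 0 \<in> I then b else m i)" for i
  have "s i \<in> {0, 1}" if "i < n" for i
    using cube_val[OF a that] by (auto simp: s_def m_def b_def)
  moreover have "s i = a i" if "i \<notin> I" for i
    using that by (cases "i = 0") (auto simp: s_def m_def)
  moreover have "s i = undefined" if "\<not> i < n" for i
    using that I a by (auto simp: s_def m_def cube_def PiE_iff extensional_def)
  ultimately have "s \<in> subcube n I a"
    using I a by (auto simp: subcube_def cube_def PiE_iff extensional_def subset_iff)
  moreover have "s(0 := 0) = m(0 := 0)" by (simp add: s_def fun_eq_iff)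
  then have "outgoing U s i \<longleftrightarrow> c" if "i \<in> I" for i
    using that by (auto simp: outgoing_def s_def m_def b_def)
  ultimately show "\<exists>s. s \<in> subcube n I a \<and> (\<forall>i\<in>I. outgoing U s i \<longleftrightarrow> c)" by blast
next
  fix s s' assume s: "s \<in> subcube n I a \<and> (\<forall>i\<in>I. outgoing U s i \<longleftrightarrow> c)"
    and s': "s' \<in> subcube n I a \<and> (\<forall>i\<in>I. outgoing U s' i \<longleftrightarrow> c)"
  then have sc: "s \<in> cube n" "s' \<in> cube n" by (auto simp: subcube_def)
  have ne0: "s i = s' i" if "i \<noteq> 0" for i
  proof (cases "i < n")
    case True
    show ?thesis
    proof (cases "i \<in> I")
      case True
      then have "s i = 0 \<longleftrightarrow> s' i = 0" using s s' that by (auto simp: outgoing_def)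
      then show ?thesis using cube_val[OF sc(1) \<open>i < n\<close>] cube_val[OF sc(2) \<open>i < n\<close>] by auto
    next
      case False
      then show ?thesis using s s' True by (simp add: subcube_def)
    qed
  next
    case False
    then show ?thesis using sc by (auto simp: cube_def PiE_iff extensional_def)
  qed
  then have base: "s(0 := 0) = s'(0 := 0)" by auto
  have "s 0 = s' 0"
  proof (cases "0 \<in> I")
    case True
    then have "0 < n" using I by auto
    have "outgoing U s 0 = c" "outgoing U s' 0 = c" using s s' True by auto
    then have "s 0 = 0 \<longleftrightarrow> s' 0 = 0" using base unfolding outgoing_def by (cases c) auto
    then show ?thesis using cube_val[OF sc(1) \<open>0 < n\<close>] cube_val[OF sc(2) \<open>0 < n\<close>] by auto
  next
    case False
    then show ?thesis using s s' sc by (cases "0 < n") (auto simp: subcube_def cube_def PiE_iff extensional_def)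
  qed
  with ne0 show "s = s'" by (metis ext)
qed

definition flip :: "(nat \<Rightarrow> nat) \<Rightarrow> nat set \<Rightarrow> nat \<Rightarrow> nat" where
  "flip s A i = (if i \<in> A then 1 - s i else s i)"

lemma flip_empty [simp]: "flip s {} = s"
  by (simp add: flip_def fun_eq_iff)

lemma flip_insert: "i \<notin> A \<Longrightarrow> flip s (insert i A) = toggle i (flip s A)"
  by (auto simp: flip_def toggle_def fun_eq_iff)

lemma flip_eq_iff: "flip s A = flip s B \<longleftrightarrow> A = B"
proof
  assume eq: "flip s A = flip s B"
  have "i \<in> A \<longleftrightarrow> i \<in> B" for i
  proof -
    have "1 - s i \<noteq> s i" by arith
    then show ?thesis using fun_cong[OF eq, of i] by (auto simp: flip_def split: if_splits)
  qed
  then show "A = B" by blast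
qed simp

lemma flip_in_subcube: "s \<in> subcube n I a \<Longrightarrow> A \<subseteq> I \<Longrightarrow> I \<subseteq> {..<n} \<Longrightarrow> flip s A \<in> subcube n I a"
  by (auto simp: subcube_def flip_def cube_def PiE_iff extensional_def)

definition walk :: "(nat \<Rightarrow> nat) \<Rightarrow> nat list \<Rightarrow> (nat \<Rightarrow> nat) list" where
  "walk s cs = map (\<lambda>t. flip s (set (take t cs))) [0..<Suc (length cs)]"

lemma set_walk: "set (walk s cs) = (\<lambda>t. flip s (set (take t cs))) ` {..length cs}"
  by (auto simp: walk_def simp del: upt_Suc)

lemma dpath_in_walk:
  assumes I: "I \<subseteq> {..<n}" and s: "s \<in> subcube n I a" and cs: "distinct cs" "set cs \<subseteq> I"
    and out: "\<And>A i. A \<subseteq> set cs \<Longrightarrow> i \<in> set cs \<Longrightarrow> i \<notin> A \<Longrightarrow> outgoing U (flip s A) i"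
  shows "dpath_in (twisted_orientation n U) (subcube n I a) s (flip s (set cs)) (walk s cs)"
  unfolding dpath_in_def
proof (intro conjI)
  let ?f = "\<lambda>t. flip s (set (take t cs))"
  show "walk s cs \<noteq> []" by (simp add: walk_def)
  show "hd (walk s cs) = s" by (simp add: walk_def hd_map del: upt_Suc)
  show "last (walk s cs) = flip s (set cs)" by (simp add: walk_def)
  have sub: "?f t \<in> subcube n I a" for t
    using flip_in_subcube[OF s _ I] cs(2) set_take_subset by (metis order_trans)
  then show "set (walk s cs) \<subseteq> subcube n I a" by (auto simp: set_walk)
  have "inj_on ?f {..length cs}"
  proof (rule inj_onI)
    fix t t' assume "t \<in> {..length cs}" "t' \<in> {..length cs}" "?f t = ?f t'"
    then have "card (set (take t cs)) = card (set (take t' cs))" and t: "t \<le> length cs" "t' \<le> length cs"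
      by (auto simp: flip_eq_iff)
    then show "t = t'" using cs(1) by (simp add: distinct_card)
  qed
  then have "inj_on ?f (set [0..<Suc (length cs)])" by (rule inj_on_subset) auto
  then show "distinct (walk s cs)" unfolding walk_def by (simp only: distinct_map distinct_upt)
  show "successively (\<lambda>v w. (v, w) \<in> twisted_orientation n U) (walk s cs)"
    unfolding successively_conv_nth
  proof (intro allI impI)
    fix t assume "Suc t < length (walk s cs)"
    then have t: "t < length cs" by (simp add: walk_def)
    have notin: "cs ! t \<notin> set (take t cs)"
      using t cs(1) by (auto simp: in_set_conv_nth distinct_conv_nth)
    have "?f (Suc t) = toggle (cs ! t) (?f t)"
      using flip_insert[OF notin] t by (simp add: take_Suc_conv_app_nth)
    moreover have "outgoing U (?f t) (cs ! t)"
      using out[OF set_take_subset _ notin] t by simp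
    moreover have "cs ! t < n" using t cs(2) I by (meson lessThan_iff nth_mem subsetD)
    moreover have "?f t \<in> cube n" using sub by (simp add: subcube_def)
    ultimately have "(?f t, ?f (Suc t)) \<in> twisted_orientation n U"
      by (auto simp: twisted_orientation_iff)
    then show "(walk s cs ! t, walk s cs ! Suc t) \<in> twisted_orientation n U"
      using t by (simp add: walk_def del: upt_Suc)
  qed
qed

lemma set_take_rotate:
  assumes "t \<le> length L"
  shows "set (take t (rotate j L)) = (\<lambda>u. L ! ((j + u) mod length L)) ` {..<t}"
  using assms by (force simp: set_conv_nth nth_rotate)

text \<open>Two cyclic intervals of the same length \<open>t\<close>, neither empty nor the whole cycle, coincide only if
  they start at the same place: if \<open>j\<close> lies in the interval starting at \<open>j'\<close> but is not its start,
  then its predecessor lies in that interval as well, but not in the one starting at \<open>j\<close>.\<close>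

lemma cyclic_intervals_distinct:
  assumes L: "distinct L" and j: "j < length L" "j' < length L" "j \<noteq> j'"
    and t: "t \<le> length L" "t' \<le> length L"
    and eq: "set (take t (rotate j L)) = set (take t' (rotate j' L))"
  shows "t = t' \<and> (t = 0 \<or> t = length L)"
proof -
  let ?k = "length L"
  have "t = t'" using arg_cong[OF eq, of card] L t by (simp add: distinct_card)
  moreover have False if "0 < t" "t < ?k"
  proof -
    have k: "0 < ?k" using j(1) by linarith
    have inj: "x = y" if "L ! x = L ! y" "x < ?k" "y < ?k" for x y
      using that L by (simp add: nth_eq_iff_index_eq)
    have eq': "(\<lambda>u. L ! ((j + u) mod ?k)) ` {..<t} = (\<lambda>u. L ! ((j' + u) mod ?k)) ` {..<t}"
      using eq \<open>t = t'\<close> t by (simp add: set_take_rotate)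
    have "L ! j \<in> (\<lambda>u. L ! ((j + u) mod ?k)) ` {..<t}"
      using j that by (intro image_eqI[of _ _ 0]) auto
    then obtain u where u: "L ! j = L ! ((j' + u) mod ?k)" "u < t" unfolding eq' by auto
    then have ju: "j = (j' + u) mod ?k" using j k by (intro inj) auto
    with j have "u \<noteq> 0" by (cases "u = 0") auto
    then obtain u' where u': "u = Suc u'" by (cases u) auto
    have "L ! ((j' + u') mod ?k) \<in> (\<lambda>u. L ! ((j + u) mod ?k)) ` {..<t}"
      unfolding eq' using u u' by auto
    then obtain w where w: "L ! ((j' + u') mod ?k) = L ! ((j + w) mod ?k)" "w < t" by auto
    then have "(j' + u') mod ?k = (j + w) mod ?k" using k by (intro inj) auto
    then have "Suc (j' + u') mod ?k = Suc (j + w) mod ?k" by (metis mod_Suc_eq)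
    then have "j = (j + Suc w) mod ?k" using ju u' by simp
    moreover have "(j + Suc w) mod ?k \<noteq> j"
      using j w that by (cases "j + Suc w < ?k") (auto simp: le_mod_geq not_less)
    ultimately show False by simp
  qed
  ultimately show ?thesis using t by (cases "0 < t \<and> t < ?k") auto
qed

text \<open>The vertices on these walks are the flips of cyclic intervals, so two walks meet only where the
  interval is empty or everything.\<close>

lemma rotated_walks_disjoint:
  assumes L: "distinct L" and j: "j < length L" "j' < length L" "j \<noteq> j'"
  shows "set (walk s (rotate j L)) \<inter> set (walk s (rotate j' L)) = {s, flip s (set L)}"
proof
  have "s \<in> set (walk s (rotate i L))" for i
    unfolding set_walk by (rule image_eqI[of _ _ 0]) auto
  moreover have "flip s (set L) \<in> set (walk s (rotate i L))" for i
    unfolding set_walk by (rule image_eqI[of _ _ "length L"]) auto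
  ultimately show "{s, flip s (set L)} \<subseteq> set (walk s (rotate j L)) \<inter> set (walk s (rotate j' L))" by blast
  show "set (walk s (rotate j L)) \<inter> set (walk s (rotate j' L)) \<subseteq> {s, flip s (set L)}"
  proof
    fix x assume "x \<in> set (walk s (rotate j L)) \<inter> set (walk s (rotate j' L))"
    then obtain t t' where t: "t \<le> length L" "t' \<le> length L"
      and x: "x = flip s (set (take t (rotate j L)))" "x = flip s (set (take t' (rotate j' L)))"
      unfolding set_walk by auto
    then have "set (take t (rotate j L)) = set (take t' (rotate j' L))"
      by (metis flip_eq_iff)
    from cyclic_intervals_distinct[OF L j t this] x(1) show "x \<in> {s, flip s (set L)}" by auto
  qed
qed

lemma rotated_walks_inj:
  assumes L: "distinct L"
  shows "inj_on (\<lambda>j. walk s (rotate j L)) {..<length L}"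
proof (rule inj_onI, rule ccontr)
  fix j j' assume j: "j \<in> {..<length L}" "j' \<in> {..<length L}" "j \<noteq> j'"
    and eq: "walk s (rotate j L) = walk s (rotate j' L)"
  then have k: "2 \<le> length L" by auto
  have "flip s (set (take 1 (rotate j L))) \<in> set (walk s (rotate j L))"
    unfolding set_walk using k by (intro imageI) auto
  then have "flip s (set (take 1 (rotate j L))) \<in> {s, flip s (set L)}"
    using rotated_walks_disjoint[OF L, of j j' s] j eq by auto
  then have "set (take 1 (rotate j L)) = {} \<or> set (take 1 (rotate j L)) = set L"
    using flip_eq_iff[of s _ "{}"] by (auto simp: flip_eq_iff)
  moreover have "card (set (take 1 (rotate j L))) = 1"
    using k L by (subst distinct_card) auto
  ultimately have "card (set L) = 1" by auto
  then show False using k L by (simp add: distinct_card)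
qed

text \<open>Upward closedness of \<open>U\<close> in the \<open>(n - 1)\<close>-cube of the vertices whose coordinate \<open>0\<close> is \<open>0\<close>.\<close>

definition monotone_base :: "nat \<Rightarrow> (nat \<Rightarrow> nat) set \<Rightarrow> bool" where
  "monotone_base n U \<longleftrightarrow> (\<forall>v\<in>cube n. \<forall>w\<in>cube n.
     v 0 = 0 \<and> w 0 = 0 \<and> (\<forall>i<n. v i \<le> w i) \<and> v \<in> U \<longrightarrow> w \<in> U)"

text \<open>If from \<open>s\<close> the directions in \<open>K\<close> can be flipped in any order, flipping them in the \<open>card K\<close>
  cyclic rotations of one fixed order gives paths that meet only at their ends.\<close>

lemma cyclic_disjoint_paths:
  assumes I: "I \<subseteq> {..<n}" and s: "s \<in> subcube n I a" and K: "K \<subseteq> I"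
    and out: "\<And>A i. A \<subseteq> K \<Longrightarrow> i \<in> K \<Longrightarrow> i \<notin> A \<Longrightarrow> outgoing U (flip s A) i"
  shows "\<exists>P. finite P \<and> card P = card K \<and>
    (\<forall>xs\<in>P. dpath_in (twisted_orientation n U) (subcube n I a) s (flip s K) xs \<and>
      set xs \<subseteq> flip s ` Pow K) \<and>
    (\<forall>xs\<in>P. \<forall>ys\<in>P. xs \<noteq> ys \<longrightarrow> set xs \<inter> set ys = {s, flip s K})"
proof -
  have "finite K" using finite_subset[OF K finite_subset[OF I]] by simp
  from finite_distinct_list[OF this] obtain L where L: "set L = K" "distinct L" by blast
  have len: "length L = card K" using L distinct_card by metis
  let ?P = "(\<lambda>j. walk s (rotate j L)) ` {..<length L}"
  show ?thesis
  proof (intro exI[of _ ?P] conjI ballI impI)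
    show "finite ?P" by simp
    show "card ?P = card K" using card_image[OF rotated_walks_inj[OF L(2)]] len by simp
    fix xs assume "xs \<in> ?P"
    then obtain j where j: "j < length L" "xs = walk s (rotate j L)" by blast
    show "dpath_in (twisted_orientation n U) (subcube n I a) s (flip s K) xs"
      using dpath_in_walk[OF I s, of "rotate j L" U] L K out j(2) by auto
    show "set xs \<subseteq> flip s ` Pow K"
      unfolding j(2) set_walk using L(1) set_take_subset[of _ "rotate j L"] by auto
    fix ys assume "ys \<in> ?P" "xs \<noteq> ys"
    then obtain j' where j': "j' < length L" "ys = walk s (rotate j' L)" by blast
    with j \<open>xs \<noteq> ys\<close> have "j \<noteq> j'" by blast
    from rotated_walks_disjoint[OF L(2) j(1) j'(1) this] show "set xs \<inter> set ys = {s, flip s K}"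
      unfolding j(2) j'(2) L(1) .
  qed
qed

text \<open>Let \<open>s'\<close> and \<open>t'\<close> be the projections of source and sink to the \<open>(n - 1)\<close>-cube. If both or
  neither belong to \<open>U\<close>, then by monotonicity the same is true of all points between them; the
  orientation of the face is then that of a cube in which all coordinates may be flipped in any order
  starting at \<open>s\<close>, and the cyclic paths suffice. Otherwise \<open>s'\<close> is outside and \<open>t'\<close> inside \<open>U\<close>, and
  \<open>s\<close> and \<open>t\<close> both lie in the facet where coordinate \<open>0\<close> is \<open>1\<close>. The cyclic paths within that
  facet are one too few; the missing path starts by crossing to the opposite facet, runs there
  parallel to the others, and crosses back at the end. The same argument covers faces in which
  coordinate \<open>0\<close> is fixed, as an instance of the first case.\<close>

lemma twisted_orientation_disjoint_paths:
  assumes U: "monotone_base n U" and I: "I \<subseteq> {..<n}"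
    and src: "is_source (twisted_orientation n U) (subcube n I a) s"
    and snk: "is_sink (twisted_orientation n U) (subcube n I a) t"
  shows "\<exists>P. finite P \<and> card I \<le> card P \<and>
    (\<forall>xs\<in>P. dpath_in (twisted_orientation n U) (subcube n I a) s t xs) \<and>
    (\<forall>xs\<in>P. \<forall>ys\<in>P. xs \<noteq> ys \<longrightarrow> set xs \<inter> set ys = {s, t})"
proof -
  let ?D = "twisted_orientation n U" and ?F = "subcube n I a"
  have s: "s \<in> ?F" "\<And>i. i \<in> I \<Longrightarrow> outgoing U s i"
    using src by (auto simp: is_source_twisted_iff[OF I])
  have t: "t \<in> ?F" "\<And>i. i \<in> I \<Longrightarrow> \<not> outgoing U t i"
    using snk by (auto simp: is_sink_twisted_iff[OF I])
  have finI: "finite I" using finite_subset[OF I] by simp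
  have sc: "s \<in> cube n" and tc: "t \<in> cube n" using s t by (auto simp: subcube_def)
  have s0: "s i = 0" and t1: "t i = 1" if "i \<in> I" "i \<noteq> 0" for i
    using s(2)[OF that(1)] t(2)[OF that(1)] that I cube_val[OF tc, of i] by (auto simp: outgoing_def)
  have eq: "t i = s i" if "i \<notin> I" for i
  proof (cases "i < n")
    case True
    then show ?thesis using s(1) t(1) that by (simp add: subcube_def)
  next
    case False
    then show ?thesis using sc tc by (auto simp: cube_def PiE_iff extensional_def)
  qed
  have out_ne0: "outgoing U (flip s A) i" if "i \<in> I" "i \<notin> A" "i \<noteq> 0" for A i
    using that s0 by (simp add: outgoing_def flip_def)
  have mono: "w \<in> U" if "v \<in> U" "v \<in> cube n" "w \<in> cube n" "v 0 = 0" "w 0 = 0"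
    "\<And>i. i < n \<Longrightarrow> v i \<le> w i" for v w
    using U that unfolding monotone_base_def by blast
  have base_cube: "v(0 := 0) \<in> cube n" if "v \<in> cube n" "0 < n" for v
    using that by (auto simp: cube_def PiE_iff extensional_def)
  consider (same) "0 \<in> I \<Longrightarrow> s(0 := 0) \<in> U \<longleftrightarrow> t(0 := 0) \<in> U"
    | (change) "0 \<in> I" "(s(0 := 0) \<in> U) \<noteq> (t(0 := 0) \<in> U)" by blast
  then show ?thesis
  proof cases
    case same
    have "outgoing U (flip s A) i" if A: "A \<subseteq> I" and i: "i \<in> I" "i \<notin> A" for A i
    proof (cases "i = 0")
      case True
      then have n: "0 < n" using i I by auto
      have Ac: "flip s A \<in> cube n" using flip_in_subcube[OF s(1) A I] by (simp add: subcube_def)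
      have A0: "0 \<notin> A" using i True by simp
      have le1: "(s(0 := 0)) j \<le> ((flip s A)(0 := 0)) j" for j
        using A A0 s0[of j] by (cases "j \<in> A") (auto simp: flip_def)
      have le2: "((flip s A)(0 := 0)) j \<le> (t(0 := 0)) j" for j
        using A A0 s0[of j] t1[of j] eq[of j] by (cases "j \<in> I") (auto simp: flip_def)
      have "s(0 := 0) \<in> U \<Longrightarrow> (flip s A)(0 := 0) \<in> U"
        by (rule mono[OF _ base_cube[OF sc n] base_cube[OF Ac n] _ _ le1]) (assumption | simp)+
      moreover have "(flip s A)(0 := 0) \<in> U \<Longrightarrow> t(0 := 0) \<in> U"
        by (rule mono[OF _ base_cube[OF Ac n] base_cube[OF tc n] _ _ le2]) (assumption | simp)+
      ultimately have "(flip s A)(0 := 0) \<in> U \<longleftrightarrow> s(0 := 0) \<in> U"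
        using same i True by blast
      moreover have "flip s A 0 = s 0" using A0 by (simp add: flip_def)
      ultimately show ?thesis using s(2)[OF i(1)] True by (simp add: outgoing_def)
    qed (use out_ne0 i in blast)
    note out = this
    have "t = flip s I"
    proof
      fix i
      show "t i = flip s I i"
      proof (cases "i \<in> I")
        case True
        show ?thesis
        proof (cases "i = 0")
          case True
          then have "0 < n" "0 \<in> I" using \<open>i \<in> I\<close> I by auto
          then have "(s 0 = 0) \<noteq> (t 0 = 0)"
            using s(2)[of 0] t(2)[of 0] same by (auto simp: outgoing_def)
          then show ?thesis
            using cube_val[OF sc \<open>0 < n\<close>] cube_val[OF tc \<open>0 < n\<close>] True \<open>0 \<in> I\<close> by (auto simp: flip_def)
        next
          case False
          then show ?thesis using s0 t1 True by (simp add: flip_def)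
        qed
      qed (simp add: eq flip_def)
    qed
    have "\<exists>P. finite P \<and> card P = card I \<and>
      (\<forall>xs\<in>P. dpath_in ?D ?F s (flip s I) xs \<and> set xs \<subseteq> flip s ` Pow I) \<and>
      (\<forall>xs\<in>P. \<forall>ys\<in>P. xs \<noteq> ys \<longrightarrow> set xs \<inter> set ys = {s, flip s I})"
      by (rule cyclic_disjoint_paths[OF I s(1) order_refl]) (rule out)
    then show ?thesis unfolding \<open>t = flip s I\<close>[symmetric] by (elim ex_forward) simp
  next
    case change
    then have n: "0 < n" using I by auto
    have "s(0 := 0) \<in> U \<Longrightarrow> t(0 := 0) \<in> U"
    proof (rule mono[OF _ base_cube[OF sc n] base_cube[OF tc n]])
      show "(s(0 := 0)) j \<le> (t(0 := 0)) j" for j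
        using s0[of j] t1[of j] eq[of j] by (cases "j \<in> I") auto
    qed auto
    with change have sU: "s(0 := 0) \<notin> U" and tU: "t(0 := 0) \<in> U" by auto
    have s00: "s 0 = 1"
      using s(2)[OF change(1)] sU cube_val[OF sc n] by (auto simp: outgoing_def)
    have t00: "t 0 = 1"
      using t(2)[OF change(1)] tU cube_val[OF tc n] by (auto simp: outgoing_def)
    \<comment> \<open>The face directions within the facet that contains both \<open>s\<close> and \<open>t\<close>.\<close>
    define K where "K = I - {0}"
    have K: "K \<subseteq> I" "0 \<notin> K" "finite K" "card I = Suc (card K)"
      using finI change(1) card_Suc_Diff1[OF finI change(1)] by (auto simp: K_def)
    have tK: "t = flip s K"
    proof
      show "t i = flip s K i" for i
        using s0[of i] t1[of i] eq[of i] s00 t00 by (cases "i = 0") (auto simp: flip_def K_def)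
    qed
    have "\<exists>P. finite P \<and> card P = card K \<and>
      (\<forall>xs\<in>P. dpath_in ?D ?F s t xs \<and> set xs \<subseteq> flip s ` Pow K) \<and>
      (\<forall>xs\<in>P. \<forall>ys\<in>P. xs \<noteq> ys \<longrightarrow> set xs \<inter> set ys = {s, t})"
      unfolding tK
    proof (rule cyclic_disjoint_paths[OF I s(1) K(1)])
      fix A i assume "i \<in> K" "i \<notin> A"
      then show "outgoing U (flip s A) i" using out_ne0[of i A] by (simp add: K_def)
    qed
    then obtain P where P: "finite P" "card P = card K"
      and paths: "\<forall>xs\<in>P. dpath_in ?D ?F s t xs \<and> set xs \<subseteq> flip s ` Pow K"
      and disj: "\<forall>xs\<in>P. \<forall>ys\<in>P. xs \<noteq> ys \<longrightarrow> set xs \<inter> set ys = {s, t}"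
      by (elim exE conjE)
    note P = P paths[THEN bspec, THEN conjunct1] paths[THEN bspec, THEN conjunct2] disj[rule_format]
    obtain L where L: "set L = K" "distinct L" using finite_distinct_list[OF K(3)] by blast
    define s' where "s' = toggle 0 s"
    have s': "s' \<in> ?F" unfolding s'_def using toggle_in_subcube_iff[OF s(1) n] change(1) by simp
    have s'0: "s' 0 = 0" using s00 by (simp add: s'_def toggle_def)
    have s'i: "s' i = s i" if "i \<noteq> 0" for i using that by (simp add: s'_def toggle_def)
    define M where "M = walk s' L"
    have M: "dpath_in ?D ?F s' (flip s' K) M"
      unfolding M_def L(1)[symmetric]
    proof (rule dpath_in_walk[OF I s' L(2)])
      show "set L \<subseteq> I" using L K by simp
      fix A i assume i: "i \<in> set L" "i \<notin> A"
      then have "i \<in> I" "i \<noteq> 0" using L(1) by (auto simp: K_def)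
      with i(2) show "outgoing U (flip s' A) i" using s0 s'i by (simp add: outgoing_def flip_def)
    qed
    have t': "flip s' K = toggle 0 t"
      unfolding tK s'_def using K(2) by (auto simp: flip_def toggle_def fun_eq_iff)
    have M0: "x 0 = 0" if "x \<in> set M" for x
      using that K(2) L(1) s'0 unfolding M_def set_walk by (auto simp: flip_def dest: in_set_takeD)
    have sM: "s \<notin> set M" "t \<notin> set M" using M0 s00 t00 by force+
    have "s \<noteq> t" using change(2) by blast
    \<comment> \<open>The path through the opposite facet.\<close>
    define ms where "ms = s # M @ [t]"
    have edge1: "(s, s') \<in> ?D"
      using sc n s(2)[OF change(1)] by (auto simp: twisted_orientation_iff s'_def)
    have "\<not> outgoing U t 0" using t(2) change(1) by blast
    then have "outgoing U (toggle 0 t) 0" using outgoing_toggle[OF tc n] by simp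
    then have edge2: "(toggle 0 t, t) \<in> ?D"
      using toggle_in_cube[OF tc n] toggle_toggle[OF tc n] n by (auto simp: twisted_orientation_iff)
    have ms: "dpath_in ?D ?F s t ms"
      using M sM \<open>s \<noteq> t\<close> s(1) t(1) edge1 edge2
      unfolding dpath_in_def ms_def t' by (auto simp: successively_append_iff successively_Cons)
    have meet: "set ms \<inter> set xs = {s, t}" if "xs \<in> P" for xs
    proof
      have "s \<in> set xs" "t \<in> set xs"
        using P(3)[OF that] hd_in_set[of xs] last_in_set[of xs] by (auto simp: dpath_in_def)
      then show "{s, t} \<subseteq> set ms \<inter> set xs" by (simp add: ms_def)
      have "x 0 = 1" if x: "x \<in> set xs" for x
      proof -
        obtain A where "A \<subseteq> K" "x = flip s A" using P(4)[OF \<open>xs \<in> P\<close>] x by blast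
        then show ?thesis using K(2) s00 by (auto simp: flip_def)
      qed
      then have "set M \<inter> set xs = {}" using M0 by force
      then show "set ms \<inter> set xs \<subseteq> {s, t}" by (auto simp: ms_def)
    qed
    have "M \<noteq> []" using M by (simp add: dpath_in_def)
    then obtain x where x: "x \<in> set M" by (cases M) auto
    have "ms \<notin> P"
    proof
      assume "ms \<in> P"
      from meet[OF this] x have "x \<in> {s, t}" by (auto simp: ms_def)
      with x sM show False by auto
    qed
    then have "card (insert ms P) = card I" using P(1,2) K(4) by simp
    moreover have "dpath_in ?D ?F s t xs" if "xs \<in> insert ms P" for xs using that ms P(3) by blast
    moreover have "set xs \<inter> set ys = {s, t}" if "xs \<in> insert ms P" "ys \<in> insert ms P" "xs \<noteq> ys" for xs ys
      using that meet P(5) by (metis insertE inf_commute)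
    ultimately show ?thesis using P(1) by (intro exI[of _ "insert ms P"]) auto
  qed
qed

text \<open>The sources, the sinks and acyclicity come from the shape of the orientation; the monotonicity of
  \<open>U\<close> supplies the disjoint paths.\<close>

theorem holt_klee_twisted_orientation:
  assumes n: "0 < n" and U: "monotone_base n U"
  shows "holt_klee n (twisted_orientation n U)"
  unfolding holt_klee_def
proof (intro conjI allI impI)
  show "cube_orientation n (twisted_orientation n U)" by (rule cube_orientation_twisted)
  show "acyclic (twisted_orientation n U)" by (rule acyclic_twisted_orientation[OF n])
next
  fix k F assume "cube_face n k F"
  then obtain I a where I: "I \<subseteq> {..<n}" "a \<in> cube n" "F = subcube n I a"
    unfolding cube_face_def subcube_def by blast
  show "\<exists>!s. is_source (twisted_orientation n U) F s"
    unfolding I(3) is_source_twisted_iff[OF I(1)] using ex1_constant_outgoing[OF I(1,2), of U True] by simp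
  show "\<exists>!t. is_sink (twisted_orientation n U) F t"
    unfolding I(3) is_sink_twisted_iff[OF I(1)] using ex1_constant_outgoing[OF I(1,2), of U False] by simp
next
  fix k F s t
  assume *: "cube_face n k F \<and> is_source (twisted_orientation n U) F s \<and> is_sink (twisted_orientation n U) F t"
  then obtain I a where I: "I \<subseteq> {..<n}" "F = subcube n I a" "card I = k"
    unfolding cube_face_def subcube_def by blast
  show "\<exists>P. finite P \<and> k \<le> card P \<and> (\<forall>xs\<in>P. dpath_in (twisted_orientation n U) F s t xs) \<and>
      (\<forall>xs\<in>P. \<forall>ys\<in>P. xs \<noteq> ys \<longrightarrow> set xs \<inter> set ys = {s, t})"
    using twisted_orientation_disjoint_paths[OF U I(1), of a s t] * unfolding I(2,3) by blast
qed

text \<open>The vertices of weight \<open>l\<close> form an antichain, so adding any subset of them to the set of all vertices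
  of larger weight gives an upward closed set. The subset can be read off from the directions of the
  edges in direction \<open>0\<close>.\<close>

lemma card_holt_klee_ge:
  assumes n: "0 < n"
  shows "2 ^ ((n - 1) choose l) \<le> card {D. holt_klee n D}"
proof -
  define wt where "wt v = (\<Sum>i\<in>{1..<n}. v i)" for v :: "nat \<Rightarrow> nat"
  define Lay where "Lay = {v \<in> cube n. v 0 = 0 \<and> wt v = l}"
  define up where "up S = S \<union> {v. l < wt v}" for S
  have up: "monotone_base n (up S)" if "S \<subseteq> Lay" for S
    unfolding monotone_base_def
  proof (intro ballI impI)
    fix v w assume v: "v \<in> cube n" and w: "w \<in> cube n"
      and vw: "v 0 = 0 \<and> w 0 = 0 \<and> (\<forall>i<n. v i \<le> w i) \<and> v \<in> up S"
    have le: "wt v \<le> wt w" unfolding wt_def using vw by (intro sum_mono) auto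
    show "w \<in> up S"
    proof (cases "l < wt w")
      case False
      then have "v \<in> S" "wt v = wt w" using vw le that by (auto simp: up_def Lay_def)
      have "v i = w i" for i
      proof (cases "i \<in> {1..<n}")
        case True
        show ?thesis
        proof (rule ccontr)
          assume "v i \<noteq> w i"
          then have "v i < w i" using vw True by (simp add: le_neq_implies_less)
          then have "wt v < wt w" unfolding wt_def using True vw
            by (intro sum_strict_mono_ex1) auto
          with \<open>wt v = wt w\<close> show False by simp
        qed
      next
        case False
        then show ?thesis using vw v w by (cases "i = 0") (auto simp: cube_def PiE_iff extensional_def)
      qed
      then have "v = w" by blast
      with \<open>v \<in> S\<close> show ?thesis by (simp add: up_def)
    qed (simp add: up_def)
  qed
  have recover: "S = {v \<in> Lay. (v, toggle 0 v) \<in> twisted_orientation n (up S)}" if S: "S \<subseteq> Lay" for S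
  proof -
    have "(v, toggle 0 v) \<in> twisted_orientation n (up S) \<longleftrightarrow> v \<in> S" if v: "v \<in> Lay" for v
    proof -
      have "v(0 := 0) = v" using v by (auto simp: Lay_def)
      then show ?thesis
        using v n by (auto simp: twisted_orientation_iff toggle_eq_iff outgoing_def up_def Lay_def)
    qed
    with S show ?thesis by blast
  qed
  have "(n - 1) choose l = card {A. A \<subseteq> {1..<n} \<and> card A = l}"
    by (simp add: n_subsets)
  also have "\<dots> \<le> card Lay"
  proof (rule card_inj_on_le)
    let ?chi = "\<lambda>A i. if i < n then (if i \<in> A then 1 else 0) else undefined :: nat"
    show "finite Lay" unfolding Lay_def using finite_cube by simp
    show "inj_on ?chi {A. A \<subseteq> {1..<n} \<and> card A = l}"
    proof (rule inj_onI)
      fix A B assume AB: "A \<in> {A. A \<subseteq> {1..<n} \<and> card A = l}" "B \<in> {A. A \<subseteq> {1..<n} \<and> card A = l}"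
        and eq: "?chi A = ?chi B"
      have "i \<in> A \<longleftrightarrow> i \<in> B" if "i < n" for i
        using fun_cong[OF eq, of i] that by (auto split: if_splits)
      with AB show "A = B" by auto
    qed
    show "?chi ` {A. A \<subseteq> {1..<n} \<and> card A = l} \<subseteq> Lay"
    proof clarify
      fix A assume A: "A \<subseteq> {1..<n}" "l = card A"
      have "(\<Sum>i\<in>{1..<n}. ?chi A i) = (\<Sum>i\<in>{1..<n}. if i \<in> A then 1 else 0)"
        by (intro sum.cong) auto
      also have "\<dots> = card ({1..<n} \<inter> A)" by (simp add: sum.If_cases)
      also have "{1..<n} \<inter> A = A" using A(1) by blast
      finally show "?chi A \<in> Lay"
        using A n by (auto simp: Lay_def wt_def cube_def PiE_iff extensional_def)
    qed
  qed
  finally have "(2::nat) ^ ((n - 1) choose l) \<le> 2 ^ card Lay" by (intro power_increasing) auto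
  also have "\<dots> = card (Pow Lay)" using finite_cube by (simp add: card_Pow Lay_def)
  also have "\<dots> \<le> card {D. holt_klee n D}"
  proof (rule card_inj_on_le)
    show "inj_on (\<lambda>S. twisted_orientation n (up S)) (Pow Lay)"
    proof (rule inj_onI)
      fix S S' assume S: "S \<in> Pow Lay" "S' \<in> Pow Lay"
        and eq: "twisted_orientation n (up S) = twisted_orientation n (up S')"
      from S have "S \<subseteq> Lay" "S' \<subseteq> Lay" by auto
      from recover[OF this(1)] recover[OF this(2)] show "S = S'" unfolding eq by simp
    qed
    show "(\<lambda>S. twisted_orientation n (up S)) ` Pow Lay \<subseteq> {D. holt_klee n D}"
      using holt_klee_twisted_orientation[OF n up] by blast
    show "finite {D. holt_klee n D}"
      by (rule finite_subset[OF _ finite_cube_orientations[of n]]) (auto simp: holt_klee_def)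
  qed
  finally show ?thesis .
qed

text \<open>The middle binomial coefficient is at least the average of all \<open>n\<close> binomial coefficients
  with upper index \<open>n - 1\<close>.\<close>

lemma card_holt_klee_ge_powr:
  assumes n: "0 < n"
  shows "2 powr (2 ^ n / (2 * real n)) \<le> real (card {D. holt_klee n D})"
proof -
  let ?m = "n - 1"
  let ?b = "?m choose (?m div 2)"
  have "(2::nat) ^ ?m = (\<Sum>k\<le>?m. ?m choose k)" by (simp add: choose_row_sum)
  also have "\<dots> \<le> (\<Sum>k\<le>?m. ?b)" by (intro sum_mono binomial_maximum)
  also have "\<dots> = n * ?b" using n by simp
  finally have "real (2 ^ ?m) \<le> real (n * ?b)" using of_nat_mono by blast
  then have "2 ^ n / (2 * real n) \<le> real ?b"
    using n by (cases n) (simp_all add: field_simps)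
  then have "2 powr (2 ^ n / (2 * real n)) \<le> 2 powr real ?b" by (intro powr_mono) auto
  also have "\<dots> = real (2 ^ ?b)" by (simp add: powr_realpow)
  also have "\<dots> \<le> real (card {D. holt_klee n D})"
    using card_holt_klee_ge[OF n, of "?m div 2"] of_nat_mono by blast
  finally show ?thesis .
qed

section \<open>The fraction of linearly inducible orientations\<close>

lemma sign_pattern_bound_le_exp_cubic:
  "(3 * n\<^sup>2 * (3 * (3 ^ n * n) + 1) + 1) ^ (3 * n\<^sup>2) \<le> (2::nat) ^ (15 * n ^ 3 + 12 * n\<^sup>2)"
proof -
  \<comment> \<open>It suffices to use \<open>n \<le> y\<close> and \<open>3 ^ n \<le> 4 ^ n = y\<^sup>2\<close>.\<close>
  define y where "y = (2::nat) ^ n"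
  have "(3::nat) ^ n \<le> 4 ^ n" by (rule power_mono) auto
  also have "(4::nat) ^ n = y\<^sup>2" unfolding y_def by (simp add: power2_eq_square flip: power_mult_distrib)
  finally have 3: "3 ^ n \<le> y\<^sup>2" .
  have n: "n \<le> y" unfolding y_def using less_exp[of n] by simp
  have y1: "1 \<le> y ^ k" for k by (simp add: y_def)
  have "3 * n\<^sup>2 * (3 * (3 ^ n * n) + 1) + 1 \<le> 3 * y\<^sup>2 * (3 * (y\<^sup>2 * y) + 1) + 1"
    using 3 n by (intro add_mono mult_mono power_mono) auto
  also have "\<dots> \<le> 3 * y\<^sup>2 * (3 * (y\<^sup>2 * y) + y ^ 3) + y ^ 5"
    using y1 by (intro add_mono mult_mono) auto
  also have "\<dots> = 12 * (y\<^sup>2 * y ^ 3) + y ^ 5"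
    by (simp add: power2_eq_square power3_eq_cube)
  also have "y\<^sup>2 * y ^ 3 = y ^ 5" by (simp flip: power_add)
  also have "12 * y ^ 5 + y ^ 5 \<le> 2 ^ 4 * y ^ 5" by simp
  also have "\<dots> = 2 ^ (5 * n + 4)" by (simp add: y_def power_add power_mult[symmetric] mult.commute)
  finally have "(3 * n\<^sup>2 * (3 * (3 ^ n * n) + 1) + 1) ^ (3 * n\<^sup>2) \<le> (2 ^ (5 * n + 4)) ^ (3 * n\<^sup>2)"
    by (rule power_mono) simp
  also have "\<dots> = 2 ^ ((5 * n + 4) * (3 * n\<^sup>2))" by (simp only: power_mult)
  also have "(5 * n + 4) * (3 * n\<^sup>2) = 15 * n ^ 3 + 12 * n\<^sup>2"
    by (simp add: algebra_simps power2_eq_square power3_eq_cube)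
  finally show ?thesis .
qed

lemma bound_tendsto_0:
  "(\<lambda>n. 2 powr (15 * real n ^ 3 + 12 * real n ^ 2 + 1) / 2 powr (2 ^ n / (1 + 2 * real n))) \<longlonglongrightarrow> 0"
  by real_asymp

text \<open>The polynomial \<open>1 + 2 * n\<close> replaces \<open>2 * n\<close>, and \<open>1\<close> is added to the exponent in the numerator, so
  that both are positive also for \<open>n = 0\<close>.\<close>

lemma lp_fraction_le:
  assumes n: "0 < n"
  shows "lp_fraction n \<le> 2 powr (15 * real n ^ 3 + 12 * real n ^ 2 + 1) / 2 powr (2 ^ n / (1 + 2 * real n))"
  unfolding lp_fraction_def
proof (rule frac_le)
  have fin: "finite {D. lp_orientation n D}"
    by (rule finite_subset[OF _ finite_cube_orientations[of n]]) (auto simp: lp_orientation_def)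
  have "card {D. holt_klee n D \<and> lp_orientation n D} \<le> card {D. lp_orientation n D}"
    by (rule card_mono[OF fin]) auto
  also note card_lp_orientations_le
  also note sign_pattern_bound_le_exp_cubic
  finally have "real (card {D. holt_klee n D \<and> lp_orientation n D}) \<le> real (2 ^ (15 * n ^ 3 + 12 * n\<^sup>2))"
    by (rule of_nat_mono)
  also have "\<dots> = 2 powr real (15 * n ^ 3 + 12 * n\<^sup>2)" by (simp only: powr_realpow of_nat_power of_nat_numeral)
  also have "\<dots> \<le> 2 powr (15 * real n ^ 3 + 12 * real n ^ 2 + 1)" by (intro powr_mono) auto
  finally show "real (card {D. holt_klee n D \<and> lp_orientation n D}) \<le>
      2 powr (15 * real n ^ 3 + 12 * real n ^ 2 + 1)" .
  have "2 ^ n / (1 + 2 * real n) \<le> 2 ^ n / (2 * real n)"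
    using n by (intro divide_left_mono) auto
  then have "2 powr (2 ^ n / (1 + 2 * real n)) \<le> 2 powr (2 ^ n / (2 * real n))"
    by (intro powr_mono) auto
  also note card_holt_klee_ge_powr[OF n]
  finally show "2 powr (2 ^ n / (1 + 2 * real n)) \<le> real (card {D. holt_klee n D})" .
qed auto

theorem theorem2:
  shows "(\<exists>N. \<forall>n \<ge> N. \<exists>D. holt_klee n D \<and> \<not> lp_orientation n D) \<and>
    lp_fraction \<longlonglongrightarrow> 0 \<and>
    (\<exists>p q r :: real poly.
       (\<forall>n. 0 < poly p (real n) \<and> 0 < poly q (real n) \<and> 0 < poly r (real n)) \<and>
       (\<forall>\<^sub>F n in sequentially.
          lp_fraction n \<le>
            poly p (real n) powr poly q (real n) / 2 powr (2 ^ n / poly r (real n))))"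
proof (intro conjI)
  let ?b = "\<lambda>n. 2 powr (15 * real n ^ 3 + 12 * real n ^ 2 + 1) / 2 powr (2 ^ n / (1 + 2 * real n))"
  have le: "\<forall>\<^sub>F n in sequentially. lp_fraction n \<le> ?b n"
    using eventually_gt_at_top[of 0] by eventually_elim (rule lp_fraction_le)
  show lim: "lp_fraction \<longlonglongrightarrow> 0"
    by (rule tendsto_sandwich[OF _ le tendsto_const bound_tendsto_0])
      (simp add: lp_fraction_def)
  have "\<forall>\<^sub>F n in sequentially. lp_fraction n < 1"
    using lim by (rule order_tendstoD) simp
  then have "\<forall>\<^sub>F n in sequentially. \<exists>D. holt_klee n D \<and> \<not> lp_orientation n D"
    using eventually_gt_at_top[of 0]
  proof eventually_elim
    case (elim n)
    show ?case
    proof (rule ccontr)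
      assume "\<not> ?thesis"
      then have "{D. holt_klee n D \<and> lp_orientation n D} = {D. holt_klee n D}" by blast
      moreover have "0 < real (card {D. holt_klee n D})"
        by (rule less_le_trans[OF _ card_holt_klee_ge_powr[OF elim(2)]]) simp
      ultimately have "lp_fraction n = 1" by (simp add: lp_fraction_def)
      with elim(1) show False by simp
    qed
  qed
  then show "\<exists>N. \<forall>n \<ge> N. \<exists>D. holt_klee n D \<and> \<not> lp_orientation n D"
    by (simp add: eventually_sequentially)
  show "\<exists>p q r :: real poly.
       (\<forall>n. 0 < poly p (real n) \<and> 0 < poly q (real n) \<and> 0 < poly r (real n)) \<and>
       (\<forall>\<^sub>F n in sequentially.
          lp_fraction n \<le>
            poly p (real n) powr poly q (real n) / 2 powr (2 ^ n / poly r (real n)))"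
  proof (intro exI conjI allI)
    have q: "poly [:1, 0, 12, 15:] (real n) = 15 * real n ^ 3 + 12 * real n ^ 2 + 1" for n
      by (simp add: algebra_simps power2_eq_square power3_eq_cube)
    have r: "poly [:1, 2:] (real n) = 1 + 2 * real n" for n by simp
    show "0 < poly [:2:] (real n)" for n by simp
    show "0 < poly [:1, 0, 12, 15:] (real n)" for n unfolding q by (simp add: add_nonneg_pos)
    show "0 < poly [:1, 2:] (real n)" for n by simp
    show "\<forall>\<^sub>F n in sequentially. lp_fraction n \<le>
        poly [:2:] (real n) powr poly [:1, 0, 12, 15:] (real n) / 2 powr (2 ^ n / poly [:1, 2:] (real n))"
      using le unfolding q r by simp
  qed
qed

end
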